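(* Let $\mathcal{F}$ be a left linear track category equipped with a system of linearity tracks $\Gamma_a^{x,y}\colon a(x+y)\Rightarrow ax+ay$ satisfying the linearity track equations. Let $(E,h_E)$ be a generating graph for $\pi_0\mathcal{F}$ (over $\mathbb{Z}$), let $s_E\colon E\to U\mathcal{F}_0$ be a graph morphism lifting $h_E$, and let $s=s_E''\colon\mathcal{B}_0:=\mathbb{Z}\,\mathrm{Mon}(E)\to\mathcal{F}_0$ be the locally $\mathbb{Z}$-linear assignment induced by $s_E$. Then there exists a unique pseudo-functor $(s,\Gamma)\colon\mathcal{B}_0\to\mathcal{F}$ (with the given $s$) satisfying the following conditions for all composable morphisms of $\mathcal{B}_0$: 1. $\Gamma(x+x',y)=\Gamma(x,y)+\Gamma(x',y)$. 2. $\Gamma(x,w)=\mathrm{id}^{\square}_{s(xw)}\colon s(xw)\Rightarrow s(xw)$ if $w\in\mathrm{Mon}(E)$. 3. $\Gamma(x,y+z)=\bigl(\Gamma(x,y)+\Gamma(x,z)\bigr)\,\square\,\Gamma_{sx}^{sy,sz}$.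
   Context: **Track categories.** Groupoids are small. Morphisms of a groupoid are called tracks, $\alpha\colon x\Rightarrow y$; $\beta\,\square\,\alpha$ is the composite (first $\alpha$, then $\beta$), $\mathrm{id}^{\square}_x$ the identity track. A track category $\mathcal{T}$ is a category enriched in $(\mathrm{Gpd},\times)$; maps (degree $0$) are objects of $\mathcal{T}(A,B)$, tracks (degree $1$) are morphisms of $\mathcal{T}(A,B)$. $\mathcal{T}_0$ is the underlying category of objects and maps, with $\mathcal{T}_0(A,B)=\mathcal{T}(A,B)_0$; $\pi_0\mathcal{T}$ is the homotopy category with hom-sets $\pi_0(\mathcal{T}(A,B))$. For a map $x$ and track $\alpha$: $x\alpha:=\mathrm{id}^{\square}_x\alpha$, $\alpha x:=\alpha\,\mathrm{id}^{\square}_x$. $\mathcal{T}$ is pointed if each $\mathcal{T}(A,B)$ has a chosen object $0$ with $0y=0$, $x0=0$, and composing any track with $\mathrm{id}^{\square}_0$ on either side gives $\mathrm{id}^{\square}_0$. A left linear track category is a pointed track category in which each $\mathcal{T}(A,B)$ is an abelian group object in groupoids with zero $0_{A,B}$ and $(a+a')x=ax+a'x$ (on maps and tracks). **Linearity tracks.** A system of linearity tracks is a choice of track $\Gamma_a^{x,y}\colon a(x+y)\Rightarrow ax+ay$ in $\mathcal{T}(X,B)$ for all maps $x,y\colon X\to A$, $a\colon A\to B$. The linearity track equations, for all composable maps and all tracks $G\colon x\Rightarrow x'$, $H\colon y\Rightarrow y'$, $\alpha\colon a\Rightarrow a'$, are: (1) $\Gamma_a^{xz,yz}=\Gamma_a^{x,y}z$;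 (2) $\Gamma_{ba}^{x,y}=\Gamma_b^{ax,ay}\,\square\,b\Gamma_a^{x,y}$; (3) $\Gamma_a^{x,y}=\Gamma_a^{y,x}$; (4) $\Gamma_{a+a'}^{x,y}=\Gamma_a^{x,y}+\Gamma_{a'}^{x,y}$; (5) $(\Gamma_a^{x,y}+az)\,\square\,\Gamma_a^{x+y,z}=(ax+\Gamma_a^{y,z})\,\square\,\Gamma_a^{x,y+z}$; (6) $(aG+aH)\,\square\,\Gamma_a^{x,y}=\Gamma_a^{x',y'}\,\square\,a(G+H)$; (7) $(\alpha x+\alpha y)\,\square\,\Gamma_a^{x,y}=\Gamma_{a'}^{x,y}\,\square\,\alpha(x+y)$. (A map in place of a track denotes its identity track.) It follows that $\pi_0\mathcal{F}$ is a preadditive category. **Pseudo-functor.** For a category $\mathcal{B}_0$ and track category $\mathcal{T}$, a pseudo-functor $(s,\Gamma)\colon\mathcal{B}_0\to\mathcal{T}$ consists of a function $A\mapsto sA$ on objects, functions $s\colon\mathcal{B}_0(A,B)\to\mathcal{T}(sA,sB)_0$, and for all composable $x,y$ a track $\Gamma(x,y)\colon(sx)(sy)\Rightarrow s(xy)$, such that $\Gamma(xy,z)\,\square\,(\Gamma(x,y)(sz))=\Gamma(x,yz)\,\square\,((sx)\Gamma(y,z))$, and $s(1_A)=1_{sA}$, $\Gamma(1_B,x)=\mathrm{id}^{\square}_{sx}=\Gamma(x,1_A)$ for $x\colon A\to B$. **Generating graph.** A (directed) graph has a set of vertices and a set of edges with source and target; $U$ is the forgetful functor from categories to graphs, and its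 left adjoint $\mathrm{Mon}$ assigns to $E$ the free category (objects: vertices of $E$; morphisms: composable words in edges). For a commutative ring $R$, $R\,\mathcal{C}$ is the category with the objects of $\mathcal{C}$, hom-modules the free $R$-modules $R(\mathcal{C}(A,B))$ and $R$-bilinearly extended composition. A generating graph (over $\mathbb{Z}$) for $\pi_0\mathcal{F}$ is a graph $E$ with a graph morphism $h_E\colon E\to U\pi_0\mathcal{F}$ such that the induced $\mathbb{Z}$-linear functor $\mathbb{Z}\,\mathrm{Mon}(E)\to\pi_0\mathcal{F}$ is full and the identity on objects. A lift $s_E\colon E\to U\mathcal{F}_0$ of $h_E$ (i.e. its composite with $U\mathcal{F}_0\to U\pi_0\mathcal{F}$ is $h_E$) induces a functor $\mathrm{Mon}(E)\to\mathcal{F}_0$, and then by additive extension homomorphisms $s_E''\colon\mathbb{Z}\,\mathrm{Mon}(E)(A,B)\to\mathcal{F}(A,B)_0$ (identity on objects; not in general a functor). *)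

theory Defs
  imports
    "HOL-Algebra.Free_Abelian_Groups"
    "Graph_Theory.Arc_Walk"
begin

section \<open>Categories, groupoids, functors\<close>

text \<open>
  Composition is written in the usual order: \<open>x \<cdot>\<^bsub>C\<^esub> y\<close> is first \<open>y\<close>, then \<open>x\<close>. All operations
  of a structure are only meaningful on its carriers.
\<close>

record ('o, 'a) cat =
  Obj :: "'o set"
  Arr :: "'a set"
  Dom :: "'a \<Rightarrow> 'o"
  Cod :: "'a \<Rightarrow> 'o"
  Ide :: "'o \<Rightarrow> 'a"
  Cmp :: "'a \<Rightarrow> 'a \<Rightarrow> 'a"  (infixl \<open>\<cdot>\<index>\<close> 75)

definition Hom :: "('o, 'a, 'z) cat_scheme \<Rightarrow> 'o \<Rightarrow> 'o \<Rightarrow> 'a set" where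
  "Hom C A B = {x \<in> Arr C. Dom C x = A \<and> Cod C x = B}"

definition composable :: "('o, 'a, 'z) cat_scheme \<Rightarrow> ('a \<times> 'a) set" where
  "composable C = {(x, y). x \<in> Arr C \<and> y \<in> Arr C \<and> Dom C x = Cod C y}"

locale category =
  fixes C :: "('o, 'a, 'z) cat_scheme" (structure)
  assumes Dom_in_Obj: "x \<in> Arr C \<Longrightarrow> Dom C x \<in> Obj C"
    and Cod_in_Obj: "x \<in> Arr C \<Longrightarrow> Cod C x \<in> Obj C"
    and Ide_in_Hom: "A \<in> Obj C \<Longrightarrow> Ide C A \<in> Hom C A A"
    and Cmp_in_Hom: "x \<in> Hom C B D \<Longrightarrow> y \<in> Hom C A B \<Longrightarrow> x \<cdot> y \<in> Hom C A D"
    and Cmp_Ide: "x \<in> Hom C A B \<Longrightarrow> x \<cdot> Ide C A = x"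
    and Ide_Cmp: "x \<in> Hom C A B \<Longrightarrow> Ide C B \<cdot> x = x"
    and Cmp_assoc: "x \<in> Hom C D E \<Longrightarrow> y \<in> Hom C B D \<Longrightarrow> z \<in> Hom C A B \<Longrightarrow>
      (x \<cdot> y) \<cdot> z = x \<cdot> (y \<cdot> z)"

locale groupoid = category C
  for C :: "('o, 'a, 'z) cat_scheme" (structure) +
  assumes invertible: "x \<in> Hom C A B \<Longrightarrow>
    \<exists>y \<in> Hom C B A. y \<cdot> x = Ide C A \<and> x \<cdot> y = Ide C B"

definition prod_cat :: "('o, 'a) cat \<Rightarrow> ('p, 'b) cat \<Rightarrow> ('o \<times> 'p, 'a \<times> 'b) cat" where
  "prod_cat C D =
    \<lparr>Obj = Obj C \<times> Obj D,
     Arr = Arr C \<times> Arr D,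
     Dom = map_prod (Dom C) (Dom D),
     Cod = map_prod (Cod C) (Cod D),
     Ide = map_prod (Ide C) (Ide D),
     Cmp = (\<lambda>(x, x') (y, y'). (x \<cdot>\<^bsub>C\<^esub> y, x' \<cdot>\<^bsub>D\<^esub> y'))\<rparr>"

definition is_functor ::
  "('o, 'a, 'z) cat_scheme \<Rightarrow> ('p, 'b, 'y) cat_scheme \<Rightarrow> ('o \<Rightarrow> 'p) \<Rightarrow> ('a \<Rightarrow> 'b) \<Rightarrow> bool" where
  "is_functor C D fo fa \<longleftrightarrow>
    fo ` Obj C \<subseteq> Obj D \<and>
    (\<forall>A\<in>Obj C. \<forall>B\<in>Obj C. fa ` Hom C A B \<subseteq> Hom D (fo A) (fo B)) \<and>
    (\<forall>A\<in>Obj C. fa (Ide C A) = Ide D (fo A)) \<and>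
    (\<forall>(x, y)\<in>composable C. fa (x \<cdot>\<^bsub>C\<^esub> y) = fa x \<cdot>\<^bsub>D\<^esub> fa y)"

definition full ::
  "('o, 'a, 'z) cat_scheme \<Rightarrow> ('p, 'b, 'y) cat_scheme \<Rightarrow> ('o \<Rightarrow> 'p) \<Rightarrow> ('a \<Rightarrow> 'b) \<Rightarrow> bool" where
  "full C D fo fa \<longleftrightarrow>
    (\<forall>A\<in>Obj C. \<forall>B\<in>Obj C. \<forall>y\<in>Hom D (fo A) (fo B). \<exists>x\<in>Hom C A B. fa x = y)"


section \<open>Track categories\<close>

text \<open>
  The underlying \<open>cat\<close> record is the category of objects and maps. Hom-groupoids are taken to
  be disjoint, so that a track determines its source and target maps, and these determine the
  source and target objects. \<open>\<iota> x\<close> is the identity track of the map \<open>x\<close>, \<open>\<beta> \<box> \<alpha>\<close> is the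
  composite (first \<open>\<alpha>\<close>) in a hom-groupoid, and \<open>\<alpha> \<star> \<xi>\<close> is the enriched composition on tracks.
\<close>

record ('o, 'm, 't) track_cat = "('o, 'm) cat" +
  Trk :: "'t set"
  Src :: "'t \<Rightarrow> 'm"
  Tgt :: "'t \<Rightarrow> 'm"
  Idt :: "'m \<Rightarrow> 't"  (\<open>\<iota>\<index> _\<close> [91] 90)
  Vcmp :: "'t \<Rightarrow> 't \<Rightarrow> 't"  (infixl \<open>\<box>\<index>\<close> 55)
  Hcmp :: "'t \<Rightarrow> 't \<Rightarrow> 't"  (infixl \<open>\<star>\<index>\<close> 75)

definition tracks :: "('o, 'm, 't, 'z) track_cat_scheme \<Rightarrow> 'm \<Rightarrow> 'm \<Rightarrow> 't set" where
  "tracks T x y = {\<alpha> \<in> Trk T. Src T \<alpha> = x \<and> Tgt T \<alpha> = y}"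

definition hom_gpd :: "('o, 'm, 't, 'z) track_cat_scheme \<Rightarrow> 'o \<Rightarrow> 'o \<Rightarrow> ('m, 't) cat" where
  "hom_gpd T A B =
    \<lparr>Obj = Hom T A B,
     Arr = {\<alpha> \<in> Trk T. Src T \<alpha> \<in> Hom T A B \<and> Tgt T \<alpha> \<in> Hom T A B},
     Dom = Src T,
     Cod = Tgt T,
     Ide = Idt T,
     Cmp = Vcmp T\<rparr>"

locale track_category = category T
  for T :: "('o, 'm, 't, 'z) track_cat_scheme" (structure) +
  assumes tracks_cases: "\<alpha> \<in> Trk T \<Longrightarrow> \<exists>A\<in>Obj T. \<exists>B\<in>Obj T. \<alpha> \<in> Arr (hom_gpd T A B)"
    and hom_groupoid: "A \<in> Obj T \<Longrightarrow> B \<in> Obj T \<Longrightarrow> groupoid (hom_gpd T A B)"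
    and composition_functor: "A \<in> Obj T \<Longrightarrow> B \<in> Obj T \<Longrightarrow> D \<in> Obj T \<Longrightarrow>
      is_functor (prod_cat (hom_gpd T B D) (hom_gpd T A B)) (hom_gpd T A D)
        (\<lambda>(a, x). a \<cdot> x) (\<lambda>(\<alpha>, \<xi>). \<alpha> \<star> \<xi>)"
    and Hcmp_Ide: "\<alpha> \<in> Arr (hom_gpd T A B) \<Longrightarrow> \<alpha> \<star> \<iota> (Ide T A) = \<alpha>"
    and Ide_Hcmp: "\<alpha> \<in> Arr (hom_gpd T A B) \<Longrightarrow> \<iota> (Ide T B) \<star> \<alpha> = \<alpha>"
    and Hcmp_assoc: "\<alpha> \<in> Arr (hom_gpd T D E) \<Longrightarrow> \<beta> \<in> Arr (hom_gpd T B D) \<Longrightarrow>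
      \<gamma> \<in> Arr (hom_gpd T A B) \<Longrightarrow> (\<alpha> \<star> \<beta>) \<star> \<gamma> = \<alpha> \<star> (\<beta> \<star> \<gamma>)"

record ('o, 'm, 't) pointed_track_cat = "('o, 'm, 't) track_cat" +
  Zero :: "'o \<Rightarrow> 'o \<Rightarrow> 'm"

locale pointed_track_category = track_category T
  for T :: "('o, 'm, 't, 'z) pointed_track_cat_scheme" (structure) +
  assumes Zero_in_Hom: "A \<in> Obj T \<Longrightarrow> B \<in> Obj T \<Longrightarrow> Zero T A B \<in> Hom T A B"
    and Zero_Cmp: "y \<in> Hom T A B \<Longrightarrow> D \<in> Obj T \<Longrightarrow> Zero T B D \<cdot> y = Zero T A D"
    and Cmp_Zero: "x \<in> Hom T B D \<Longrightarrow> A \<in> Obj T \<Longrightarrow> x \<cdot> Zero T A B = Zero T A D"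
    and Zero_Hcmp: "\<xi> \<in> Arr (hom_gpd T A B) \<Longrightarrow> D \<in> Obj T \<Longrightarrow>
      \<iota> (Zero T B D) \<star> \<xi> = \<iota> (Zero T A D)"
    and Hcmp_Zero: "\<alpha> \<in> Arr (hom_gpd T B D) \<Longrightarrow> A \<in> Obj T \<Longrightarrow>
      \<alpha> \<star> \<iota> (Zero T A B) = \<iota> (Zero T A D)"

text \<open>
  An abelian group object in groupoids: the zero object \<open>z\<close> (with zero arrow its identity),
  addition \<open>p\<close> of objects and \<open>q\<close> of arrows. The diagrams for an abelian group object say that
  objects and arrows form abelian groups and that zero, addition and negation are functors.
\<close>

definition obj_group :: "('o, 'a) cat \<Rightarrow> 'o \<Rightarrow> ('o \<Rightarrow> 'o \<Rightarrow> 'o) \<Rightarrow> 'o monoid" where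
  "obj_group G z p = \<lparr>carrier = Obj G, monoid.mult = p, one = z\<rparr>"

definition arr_group :: "('o, 'a) cat \<Rightarrow> 'o \<Rightarrow> ('a \<Rightarrow> 'a \<Rightarrow> 'a) \<Rightarrow> 'a monoid" where
  "arr_group G z q = \<lparr>carrier = Arr G, monoid.mult = q, one = Ide G z\<rparr>"

definition ab_group_gpd ::
  "('o, 'a) cat \<Rightarrow> 'o \<Rightarrow> ('o \<Rightarrow> 'o \<Rightarrow> 'o) \<Rightarrow> ('a \<Rightarrow> 'a \<Rightarrow> 'a) \<Rightarrow> bool" where
  "ab_group_gpd G z p q \<longleftrightarrow>
    groupoid G \<and>
    comm_group (obj_group G z p) \<and>
    comm_group (arr_group G z q) \<and>
    is_functor (prod_cat G G) G (\<lambda>(x, y). p x y) (\<lambda>(\<alpha>, \<beta>). q \<alpha> \<beta>) \<and>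
    is_functor G G (\<lambda>x. inv\<^bsub>obj_group G z p\<^esub> x) (\<lambda>\<alpha>. inv\<^bsub>arr_group G z q\<^esub> \<alpha>)"

record ('o, 'm, 't) lin_track_cat = "('o, 'm, 't) pointed_track_cat" +
  Add :: "'m \<Rightarrow> 'm \<Rightarrow> 'm"  (infixl \<open>\<boxplus>\<index>\<close> 65)
  Tadd :: "'t \<Rightarrow> 't \<Rightarrow> 't"  (infixl \<open>\<uplus>\<index>\<close> 65)

locale left_linear_track_category = pointed_track_category T
  for T :: "('o, 'm, 't, 'z) lin_track_cat_scheme" (structure) +
  assumes hom_ab_group_gpd: "A \<in> Obj T \<Longrightarrow> B \<in> Obj T \<Longrightarrow>
      ab_group_gpd (hom_gpd T A B) (Zero T A B) (Add T) (Tadd T)"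
    and Cmp_left_linear: "a \<in> Hom T B D \<Longrightarrow> a' \<in> Hom T B D \<Longrightarrow> x \<in> Hom T A B \<Longrightarrow>
      (a \<boxplus> a') \<cdot> x = a \<cdot> x \<boxplus> a' \<cdot> x"
    and Hcmp_left_linear: "\<alpha> \<in> Arr (hom_gpd T B D) \<Longrightarrow> \<alpha>' \<in> Arr (hom_gpd T B D) \<Longrightarrow>
      \<xi> \<in> Arr (hom_gpd T A B) \<Longrightarrow> (\<alpha> \<uplus> \<alpha>') \<star> \<xi> = \<alpha> \<star> \<xi> \<uplus> \<alpha>' \<star> \<xi>"

definition map_group :: "('o, 'm, 't, 'z) lin_track_cat_scheme \<Rightarrow> 'o \<Rightarrow> 'o \<Rightarrow> 'm monoid" where
  "map_group T A B = obj_group (hom_gpd T A B) (Zero T A B) (Add T)"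


section \<open>Linearity tracks\<close>

text \<open>\<open>L a x y\<close> is the linearity track \<open>a(x + y) \<Rightarrow> ax + ay\<close>.\<close>

locale linearity_tracks = left_linear_track_category T
  for T :: "('o, 'm, 't, 'z) lin_track_cat_scheme" (structure) +
  fixes L :: "'m \<Rightarrow> 'm \<Rightarrow> 'm \<Rightarrow> 't"
  assumes lin_track: "a \<in> Hom T A B \<Longrightarrow> x \<in> Hom T X A \<Longrightarrow> y \<in> Hom T X A \<Longrightarrow>
      L a x y \<in> tracks T (a \<cdot> (x \<boxplus> y)) (a \<cdot> x \<boxplus> a \<cdot> y)"
    and lin_precomp: "a \<in> Hom T A B \<Longrightarrow> x \<in> Hom T X A \<Longrightarrow> y \<in> Hom T X A \<Longrightarrow> z \<in> Hom T Y X \<Longrightarrow>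
      L a (x \<cdot> z) (y \<cdot> z) = L a x y \<star> \<iota> z"
    and lin_comp: "b \<in> Hom T B D \<Longrightarrow> a \<in> Hom T A B \<Longrightarrow> x \<in> Hom T X A \<Longrightarrow> y \<in> Hom T X A \<Longrightarrow>
      L (b \<cdot> a) x y = L b (a \<cdot> x) (a \<cdot> y) \<box> \<iota> b \<star> L a x y"
    and lin_sym: "a \<in> Hom T A B \<Longrightarrow> x \<in> Hom T X A \<Longrightarrow> y \<in> Hom T X A \<Longrightarrow>
      L a x y = L a y x"
    and lin_add: "a \<in> Hom T A B \<Longrightarrow> a' \<in> Hom T A B \<Longrightarrow> x \<in> Hom T X A \<Longrightarrow> y \<in> Hom T X A \<Longrightarrow>
      L (a \<boxplus> a') x y = L a x y \<uplus> L a' x y"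
    and lin_cocycle: "a \<in> Hom T A B \<Longrightarrow> x \<in> Hom T X A \<Longrightarrow> y \<in> Hom T X A \<Longrightarrow> z \<in> Hom T X A \<Longrightarrow>
      (L a x y \<uplus> \<iota> (a \<cdot> z)) \<box> L a (x \<boxplus> y) z = (\<iota> (a \<cdot> x) \<uplus> L a y z) \<box> L a x (y \<boxplus> z)"
    and lin_natural: "a \<in> Hom T A B \<Longrightarrow> x \<in> Hom T X A \<Longrightarrow> x' \<in> Hom T X A \<Longrightarrow>
      y \<in> Hom T X A \<Longrightarrow> y' \<in> Hom T X A \<Longrightarrow> G \<in> tracks T x x' \<Longrightarrow> H \<in> tracks T y y' \<Longrightarrow>
      (\<iota> a \<star> G \<uplus> \<iota> a \<star> H) \<box> L a x y = L a x' y' \<box> \<iota> a \<star> (G \<uplus> H)"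
    and lin_natural_left: "a \<in> Hom T A B \<Longrightarrow> a' \<in> Hom T A B \<Longrightarrow> x \<in> Hom T X A \<Longrightarrow>
      y \<in> Hom T X A \<Longrightarrow> \<alpha> \<in> tracks T a a' \<Longrightarrow>
      (\<alpha> \<star> \<iota> x \<uplus> \<alpha> \<star> \<iota> y) \<box> L a x y = L a' x y \<box> \<alpha> \<star> \<iota> (x \<boxplus> y)"


section \<open>The homotopy category\<close>

definition htpy_class :: "('o, 'm, 't, 'z) track_cat_scheme \<Rightarrow> 'm \<Rightarrow> 'm set" where
  "htpy_class T x = {y. tracks T x y \<noteq> {}}"

text \<open>
  The union in a composite (and in a sum) of classes is over classes that all coincide; this
  is the usual definition on representatives without choosing them.
\<close>

definition pi0 :: "('o, 'm, 't, 'z) track_cat_scheme \<Rightarrow> ('o, 'm set) cat" where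
  "pi0 T =
    \<lparr>Obj = Obj T,
     Arr = htpy_class T ` Arr T,
     Dom = (\<lambda>X. the_elem (Dom T ` X)),
     Cod = (\<lambda>X. the_elem (Cod T ` X)),
     Ide = (\<lambda>A. htpy_class T (Ide T A)),
     Cmp = (\<lambda>X Y. \<Union>x\<in>X. \<Union>y\<in>Y. htpy_class T (x \<cdot>\<^bsub>T\<^esub> y))\<rparr>"

definition pi0_group ::
  "('o, 'm, 't, 'z) lin_track_cat_scheme \<Rightarrow> 'o \<Rightarrow> 'o \<Rightarrow> 'm set monoid" where
  "pi0_group T A B =
    \<lparr>carrier = Hom (pi0 T) A B,
     monoid.mult = (\<lambda>X Y. \<Union>x\<in>X. \<Union>y\<in>Y. htpy_class T (x \<boxplus>\<^bsub>T\<^esub> y)),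
     one = htpy_class T (Zero T A B)\<rparr>"


section \<open>Free categories and linearizations\<close>

text \<open>Tagging with endpoints makes the hom-sets of the categories below disjoint.\<close>

datatype ('o, 'b) mor = Mor (mdom: 'o) (mcod: 'o) (rep: 'b)

text \<open>
  \<open>Mon(E)\<close>: a word is stored as the list of its arcs in the order in which they are traversed,
  i.e. the composite \<open>e\<^sub>1 e\<^sub>2\<close> (first \<open>e\<^sub>2\<close>) is the list \<open>[e\<^sub>2, e\<^sub>1]\<close>.
\<close>

definition free_cat :: "('v, 'e) pre_digraph \<Rightarrow> ('v, ('v, 'e list) mor) cat" where
  "free_cat E =
    \<lparr>Obj = verts E,
     Arr = {x. pre_digraph.awalk E (mdom x) (rep x) (mcod x)},
     Dom = mdom,
     Cod = mcod,
     Ide = (\<lambda>v. Mor v v []),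
     Cmp = (\<lambda>x y. Mor (mdom y) (mcod x) (rep y @ rep x))\<rparr>"

text \<open>
  \<open>R C\<close>: morphisms are formal linear combinations of parallel morphisms of \<open>C\<close>, with bilinearly
  extended composition. The ring \<open>R\<close> is the type \<open>'r\<close>.
\<close>

definition linear_cat ::
  "('o, 'a, 'z) cat_scheme \<Rightarrow> ('o, ('o, 'a \<Rightarrow>\<^sub>0 'r::comm_ring_1) mor) cat" where
  "linear_cat C =
    \<lparr>Obj = Obj C,
     Arr = {x. mdom x \<in> Obj C \<and> mcod x \<in> Obj C \<and>
       Poly_Mapping.keys (rep x) \<subseteq> Hom C (mdom x) (mcod x)},
     Dom = mdom,
     Cod = mcod,
     Ide = (\<lambda>A. Mor A A (Poly_Mapping.single (Ide C A) 1)),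
     Cmp = (\<lambda>x y. Mor (mdom y) (mcod x)
       (\<Sum>u\<in>Poly_Mapping.keys (rep x). \<Sum>v\<in>Poly_Mapping.keys (rep y).
         Poly_Mapping.single (u \<cdot>\<^bsub>C\<^esub> v)
           (Poly_Mapping.lookup (rep x) u * Poly_Mapping.lookup (rep y) v)))\<rparr>"

definition lin_of ::
  "('o, 'a, 'z) cat_scheme \<Rightarrow> 'a \<Rightarrow> ('o, 'a \<Rightarrow>\<^sub>0 'r::comm_ring_1) mor" where
  "lin_of C u = Mor (Dom C u) (Cod C u) (Poly_Mapping.single u 1)"

definition lin_add ::
  "('o, 'a \<Rightarrow>\<^sub>0 'r::comm_ring_1) mor \<Rightarrow> ('o, 'a \<Rightarrow>\<^sub>0 'r) mor \<Rightarrow> ('o, 'a \<Rightarrow>\<^sub>0 'r) mor" where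
  "lin_add x y = Mor (mdom x) (mcod x) (rep x + rep y)"


section \<open>Generating graphs\<close>

definition under_graph :: "('o, 'a, 'z) cat_scheme \<Rightarrow> ('o, 'a) pre_digraph" where
  "under_graph C = \<lparr>verts = Obj C, arcs = Arr C, tail = Dom C, head = Cod C\<rparr>"

definition graph_morphism ::
  "('v, 'e) pre_digraph \<Rightarrow> ('w, 'f) pre_digraph \<Rightarrow> ('v \<Rightarrow> 'w) \<Rightarrow> ('e \<Rightarrow> 'f) \<Rightarrow> bool" where
  "graph_morphism E G fv fe \<longleftrightarrow>
    fv ` verts E \<subseteq> verts G \<and> fe ` arcs E \<subseteq> arcs G \<and>
    (\<forall>e\<in>arcs E. tail G (fe e) = fv (tail E e) \<and> head G (fe e) = fv (head E e))"

fun walk_eval ::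
  "('v, 'e) pre_digraph \<Rightarrow> ('o, 'a, 'z) cat_scheme \<Rightarrow> ('v \<Rightarrow> 'o) \<Rightarrow> ('e \<Rightarrow> 'a) \<Rightarrow> 'v \<Rightarrow> 'e list \<Rightarrow> 'a"
  where
    "walk_eval E C fv fe v [] = Ide C (fv v)"
  | "walk_eval E C fv fe v (e # es) = walk_eval E C fv fe (head E e) es \<cdot>\<^bsub>C\<^esub> fe e"

text \<open>The functor \<open>Mon(E) \<rightarrow> C\<close> induced by a graph morphism \<open>E \<rightarrow> U C\<close>, on morphisms.\<close>

definition free_extension ::
  "('v, 'e) pre_digraph \<Rightarrow> ('o, 'a, 'z) cat_scheme \<Rightarrow> ('v \<Rightarrow> 'o) \<Rightarrow> ('e \<Rightarrow> 'a) \<Rightarrow>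
    ('v, 'e list) mor \<Rightarrow> 'a" where
  "free_extension E C fv fe w = walk_eval E C fv fe (mdom w) (rep w)"

text \<open>
  The additive extension \<open>\<Sum> n\<^sub>i w\<^sub>i \<mapsto> \<Sum> n\<^sub>i h(w\<^sub>i)\<close> of \<open>h\<close>, where \<open>grp A B\<close> is the (multiplicatively
  written) abelian group structure on the target morphisms from \<open>A\<close> to \<open>B\<close>.
\<close>

definition linear_extension ::
  "('p \<Rightarrow> 'p \<Rightarrow> 'm monoid) \<Rightarrow> ('o \<Rightarrow> 'p) \<Rightarrow> ('a \<Rightarrow> 'm) \<Rightarrow> ('o, 'a \<Rightarrow>\<^sub>0 int) mor \<Rightarrow> 'm" where
  "linear_extension grp fo h x =
    finprod (grp (fo (mdom x)) (fo (mcod x)))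
      (\<lambda>w. h w [^]\<^bsub>grp (fo (mdom x)) (fo (mcod x))\<^esub> Poly_Mapping.lookup (rep x) w)
      (Poly_Mapping.keys (rep x))"

definition generating_graph ::
  "('o, 'm, 't, 'z) lin_track_cat_scheme \<Rightarrow> ('o, 'e) pre_digraph \<Rightarrow> ('o \<Rightarrow> 'o) \<Rightarrow> ('e \<Rightarrow> 'm set) \<Rightarrow> bool"
  where
  "generating_graph T E hV hE \<longleftrightarrow>
    wf_digraph E \<and>
    graph_morphism E (under_graph (pi0 T)) hV hE \<and>
    verts E = Obj T \<and> (\<forall>v\<in>verts E. hV v = v) \<and>
    full (linear_cat (free_cat E)) (pi0 T) hV
      (linear_extension (pi0_group T) hV (free_extension E (pi0 T) hV hE))"


section \<open>Pseudo-functors\<close>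

locale pseudo_functor = B: category B + T: track_category T
  for B :: "('b, 'x, 'y) cat_scheme" and T :: "('o, 'm, 't, 'z) track_cat_scheme" +
  fixes so :: "'b \<Rightarrow> 'o" and s :: "'x \<Rightarrow> 'm" and \<Gamma> :: "'x \<times> 'x \<Rightarrow> 't"
  assumes obj: "A \<in> Obj B \<Longrightarrow> so A \<in> Obj T"
    and map: "x \<in> Hom B A A' \<Longrightarrow> s x \<in> Hom T (so A) (so A')"
    and track: "(x, y) \<in> composable B \<Longrightarrow>
      \<Gamma> (x, y) \<in> tracks T (s x \<cdot>\<^bsub>T\<^esub> s y) (s (x \<cdot>\<^bsub>B\<^esub> y))"
    and coherence: "(x, y) \<in> composable B \<Longrightarrow> (y, z) \<in> composable B \<Longrightarrow>
      \<Gamma> (x \<cdot>\<^bsub>B\<^esub> y, z) \<box>\<^bsub>T\<^esub> \<Gamma> (x, y) \<star>\<^bsub>T\<^esub> \<iota>\<^bsub>T\<^esub> (s z) =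
      \<Gamma> (x, y \<cdot>\<^bsub>B\<^esub> z) \<box>\<^bsub>T\<^esub> \<iota>\<^bsub>T\<^esub> (s x) \<star>\<^bsub>T\<^esub> \<Gamma> (y, z)"
    and map_Ide: "A \<in> Obj B \<Longrightarrow> s (Ide B A) = Ide T (so A)"
    and track_Ide_left: "x \<in> Hom B A A' \<Longrightarrow> \<Gamma> (Ide B A', x) = \<iota>\<^bsub>T\<^esub> (s x)"
    and track_Ide_right: "x \<in> Hom B A A' \<Longrightarrow> \<Gamma> (x, Ide B A) = \<iota>\<^bsub>T\<^esub> (s x)"

end

theory Submission
  imports Defs
begin

text \<open>
  For a map \<open>a\<close> the tracks with source of the form \<open>a m\<close> form, together with \<open>m\<close>, an abelian group under
  \<open>(m, \<gamma>) + (m', \<gamma>') = (m + m', (\<gamma> + \<gamma>') \<box> L a m m')\<close>: associativity is the cocycle equation (5) and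
  commutativity is the symmetry (3). Condition 3 says that \<open>y \<mapsto> (s y, \<Gamma>(x, y))\<close> is a homomorphism into
  the group belonging to \<open>a = s x\<close>, and condition 2 prescribes it on the basis \<open>Mon(E)\<close>. This gives both
  uniqueness and a definition of \<open>\<Gamma>\<close>. Each further identity compares two homomorphisms of this kind, so it
  only has to be checked on words.
\<close>

section \<open>Calculus of tracks\<close>

text \<open>Composition is strictly additive in its left factor but only up to \<open>L\<close> in
  its right factor, so \<open>s x \<cdot> s y\<close> is not additive in \<open>y\<close>. Tracks
  out of such maps cannot simply be added: the plain sum has the wrong source, and the linearity
  track corrects it. The same defect keeps \<open>s\<close> from being a functor, except that right
  multiplication by a word is strict, \<open>s (x w) = s x \<cdot> h w\<close>, since precomposition
  is additive. Hence an identity track can be prescribed there.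

  The hard identity is coherence. With \<open>x\<close> and \<open>y\<close> fixed, its sides
  involve the groups of three different maps, \<open>s (x y)\<close>, \<open>s x\<close> and
  \<open>s y\<close>. Both are transported to the group of \<open>s x \<cdot> s y\<close>: one side
  along the track \<open>\<Gamma>(x, y)\<close>, by naturality of \<open>L\<close> in its left
  factor, the other by the rule for \<open>L\<close> at a composite map. For a word \<open>w\<close>
  in the last place what remains is that \<open>\<Gamma>(x, y w)\<close> is
  \<open>\<Gamma>(x, y)\<close> whiskered with \<open>h w\<close>, a second comparison in which
  \<open>y\<close> varies.\<close>

lemma (in category) Hom_Obj: "x \<in> Hom C A B \<Longrightarrow> A \<in> Obj C" "x \<in> Hom C A B \<Longrightarrow> B \<in> Obj C"
  using Dom_in_Obj Cod_in_Obj by (auto simp: Hom_def)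

lemma is_functor_Hom:
  assumes "is_functor C D fo fa" "A \<in> Obj C" "B \<in> Obj C" "x \<in> Hom C A B"
  shows "fa x \<in> Hom D (fo A) (fo B)"
  using assms unfolding is_functor_def by blast

lemma is_functor_Ide:
  assumes "is_functor C D fo fa" "A \<in> Obj C"
  shows "fa (Ide C A) = Ide D (fo A)"
  using assms unfolding is_functor_def by blast

lemma is_functor_Cmp:
  assumes "is_functor C D fo fa" "x \<in> Hom C B B'" "y \<in> Hom C A B"
  shows "fa (x \<cdot>\<^bsub>C\<^esub> y) = fa x \<cdot>\<^bsub>D\<^esub> fa y"
  using assms unfolding is_functor_def composable_def Hom_def by auto

lemma hom_gpd_simps [simp]:
  "Obj (hom_gpd T A B) = Hom T A B"
  "Dom (hom_gpd T A B) = Src T"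
  "Cod (hom_gpd T A B) = Tgt T"
  "Ide (hom_gpd T A B) = Idt T"
  "Cmp (hom_gpd T A B) = Vcmp T"
  by (simp_all add: hom_gpd_def)

lemma Arr_hom_gpd_iff:
  "\<alpha> \<in> Arr (hom_gpd T A B) \<longleftrightarrow> \<alpha> \<in> Trk T \<and> Src T \<alpha> \<in> Hom T A B \<and> Tgt T \<alpha> \<in> Hom T A B"
  by (simp add: hom_gpd_def)

lemma prod_cat_simps [simp]:
  "Obj (prod_cat C D) = Obj C \<times> Obj D"
  "Ide (prod_cat C D) (A, B) = (Ide C A, Ide D B)"
  "(x, x') \<cdot>\<^bsub>prod_cat C D\<^esub> (y, y') = (x \<cdot>\<^bsub>C\<^esub> y, x' \<cdot>\<^bsub>D\<^esub> y')"
  by (simp_all add: prod_cat_def)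

lemma Hom_prod_cat [simp]:
  "Hom (prod_cat C D) (A, A') (B, B') = Hom C A B \<times> Hom D A' B'"
  by (auto simp: prod_cat_def Hom_def)

section \<open>Vertical and horizontal composition of tracks\<close>

context track_category
begin

text \<open>\<open>tracks\<close> mentions only maps. Every track lies in some hom-groupoid, and its
  end maps reveal which one, so the objects can be recovered instead of being carried along.\<close>

lemma tracks_typed:
  assumes "\<alpha> \<in> tracks T x y"
  obtains A B where "x \<in> Hom T A B" "y \<in> Hom T A B" "\<alpha> \<in> Arr (hom_gpd T A B)"
    "A \<in> Obj T" "B \<in> Obj T"
  using assms tracks_cases unfolding tracks_def Arr_hom_gpd_iff by blast

lemma tracks_Arr:
  assumes "\<alpha> \<in> tracks T x y" "x \<in> Hom T A B"
  shows "\<alpha> \<in> Arr (hom_gpd T A B)"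
  using assms by (elim tracks_typed) (auto simp: Hom_def)

lemma tracks_Tgt:
  assumes "\<alpha> \<in> tracks T x y" "x \<in> Hom T A B"
  shows "y \<in> Hom T A B"
  using tracks_Arr[OF assms] assms(1) by (simp add: Arr_hom_gpd_iff tracks_def)

lemma Arr_tracks:
  assumes "\<alpha> \<in> Arr (hom_gpd T A B)"
  shows "\<alpha> \<in> tracks T (Src T \<alpha>) (Tgt T \<alpha>)"
  using assms by (simp add: Arr_hom_gpd_iff tracks_def)

text \<open>Translates the groupoid axioms of \<open>hom_gpd\<close> into the language of
  \<open>tracks\<close>. Only the source is typed, since a track forces its target into the same
  hom-set.\<close>

lemma Hom_hom_gpd:
  assumes "x \<in> Hom T A B"
  shows "Hom (hom_gpd T A B) x y = tracks T x y"
  using assms tracks_Tgt[OF _ assms] by (auto simp: Hom_def[of "hom_gpd T A B"] Arr_hom_gpd_iff tracks_def)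

lemma hom_groupoid_Hom: "x \<in> Hom T A B \<Longrightarrow> groupoid (hom_gpd T A B)"
  using hom_groupoid Hom_Obj by blast

lemma hom_category_Hom: "x \<in> Hom T A B \<Longrightarrow> category (hom_gpd T A B)"
  using hom_groupoid_Hom groupoid.axioms(1) by blast

lemma Idt_tracks: "x \<in> Hom T A B \<Longrightarrow> \<iota> x \<in> tracks T x x"
  using category.Ide_in_Hom[OF hom_category_Hom, of x A B x] Hom_hom_gpd by force

lemma Idt_Arr: "x \<in> Hom T A B \<Longrightarrow> \<iota> x \<in> Arr (hom_gpd T A B)"
  using Idt_tracks tracks_Arr by blast

lemma Vcmp_tracks:
  assumes "\<beta> \<in> tracks T y z" "\<alpha> \<in> tracks T x y"
  shows "\<beta> \<box> \<alpha> \<in> tracks T x z"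
  using assms(2)
proof (rule tracks_typed)
  fix A B assume "x \<in> Hom T A B" "y \<in> Hom T A B"
  then show ?thesis
    using category.Cmp_in_Hom[OF hom_category_Hom, of x A B \<beta> y z \<alpha> x] Hom_hom_gpd assms by force
qed

lemma Vcmp_Idt:
  assumes "\<alpha> \<in> tracks T x y"
  shows "\<alpha> \<box> \<iota> x = \<alpha>"
  using assms
proof (rule tracks_typed)
  fix A B assume "x \<in> Hom T A B"
  then show ?thesis
    using category.Cmp_Ide[OF hom_category_Hom, of x A B \<alpha> x y] Hom_hom_gpd assms by force
qed

lemma Idt_Vcmp:
  assumes "\<alpha> \<in> tracks T x y"
  shows "\<iota> y \<box> \<alpha> = \<alpha>"
  using assms
proof (rule tracks_typed)
  fix A B assume "x \<in> Hom T A B"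
  then show ?thesis
    using category.Ide_Cmp[OF hom_category_Hom, of x A B \<alpha> x y] Hom_hom_gpd assms by force
qed

lemma Vcmp_assoc:
  assumes "\<gamma> \<in> tracks T z w" "\<beta> \<in> tracks T y z" "\<alpha> \<in> tracks T x y"
  shows "(\<gamma> \<box> \<beta>) \<box> \<alpha> = \<gamma> \<box> (\<beta> \<box> \<alpha>)"
  using assms(2)
proof (rule tracks_typed)
  fix A B assume "y \<in> Hom T A B" "z \<in> Hom T A B" "\<beta> \<in> Arr (hom_gpd T A B)"
  moreover from this have "x \<in> Hom T A B"
    using assms(3) by (elim tracks_typed) (auto simp: Hom_def)
  ultimately show ?thesis
    using category.Cmp_assoc[OF hom_category_Hom, of x A B \<gamma> z w \<beta> y \<alpha> x] Hom_hom_gpd assms by force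
qed

lemma track_inverse:
  assumes "\<alpha> \<in> tracks T x y"
  obtains \<beta> where "\<beta> \<in> tracks T y x" "\<beta> \<box> \<alpha> = \<iota> x" "\<alpha> \<box> \<beta> = \<iota> y"
  using assms
proof (rule tracks_typed)
  fix A B assume "x \<in> Hom T A B" "y \<in> Hom T A B"
  then show ?thesis
    using groupoid.invertible[OF hom_groupoid_Hom, of x A B \<alpha> x y] Hom_hom_gpd assms that by force
qed

text \<open>The targets \<open>z\<close> and \<open>z'\<close> may differ: uniqueness arguments
  compare tracks whose targets have not yet been identified.\<close>

lemma Vcmp_right_cancel:
  assumes "\<beta> \<in> tracks T y z" "\<beta>' \<in> tracks T y z'" "\<alpha> \<in> tracks T x y" "\<beta> \<box> \<alpha> = \<beta>' \<box> \<alpha>"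
  shows "\<beta> = \<beta>'"
proof -
  obtain \<gamma> where g: "\<gamma> \<in> tracks T y x" "\<alpha> \<box> \<gamma> = \<iota> y"
    using track_inverse[OF assms(3)] by metis
  have "\<beta> = (\<beta> \<box> \<alpha>) \<box> \<gamma>"
    using Vcmp_assoc[OF assms(1,3) g(1)] g(2) Vcmp_Idt[OF assms(1)] by simp
  also have "\<dots> = \<beta>'"
    using Vcmp_assoc[OF assms(2,3) g(1)] g(2) Vcmp_Idt[OF assms(2)] assms(4) by simp
  finally show ?thesis .
qed

text \<open>Tracks from \<open>x\<close> to itself form a group, and a group has no idempotent
  besides its unit.\<close>

lemma Vcmp_idem:
  assumes "\<alpha> \<in> tracks T x x" "\<alpha> \<box> \<alpha> = \<alpha>"
  shows "\<alpha> = \<iota> x"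
proof -
  obtain A B where "x \<in> Hom T A B" using tracks_typed[OF assms(1)] by metis
  then show ?thesis
    using Vcmp_right_cancel[OF assms(1) Idt_tracks assms(1)] Idt_Vcmp[OF assms(1)] assms(2) by metis
qed

lemma
  assumes a: "a \<in> Hom T B D" and x: "x \<in> Hom T A B"
  shows Hcmp_Idt: "\<iota> a \<star> \<iota> x = \<iota> (a \<cdot> x)"
    and Hcmp_tracks: "\<alpha> \<in> tracks T a a' \<Longrightarrow> \<xi> \<in> tracks T x x' \<Longrightarrow>
      \<alpha> \<star> \<xi> \<in> tracks T (a \<cdot> x) (a' \<cdot> x')"
    and Hcmp_interchange: "\<alpha> \<in> tracks T a a' \<Longrightarrow> \<beta> \<in> tracks T a' a'' \<Longrightarrow>
      \<xi> \<in> tracks T x x' \<Longrightarrow> \<eta> \<in> tracks T x' x'' \<Longrightarrow>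
      (\<beta> \<box> \<alpha>) \<star> (\<eta> \<box> \<xi>) = (\<beta> \<star> \<eta>) \<box> (\<alpha> \<star> \<xi>)"
proof -
  have AB: "A \<in> Obj T" "B \<in> Obj T" "D \<in> Obj T"
    using a x Hom_Obj by blast+
  note F = composition_functor[OF AB]
  have c: "category (hom_gpd T A B)" "category (hom_gpd T B D)"
    using hom_category_Hom a x by auto
  have h: "a \<cdot> x \<in> Hom T A D"
    using Cmp_in_Hom[OF a x] .
  show "\<iota> a \<star> \<iota> x = \<iota> (a \<cdot> x)"
    using is_functor_Ide[OF F, of "(a, x)"] a x by simp
  show "\<alpha> \<star> \<xi> \<in> tracks T (a \<cdot> x) (a' \<cdot> x')" if "\<alpha> \<in> tracks T a a'" "\<xi> \<in> tracks T x x'"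
  proof -
    have "a' \<in> Hom T B D" "x' \<in> Hom T A B"
      using that a x tracks_Tgt by blast+
    then show ?thesis
      using is_functor_Hom[OF F, of "(a, x)" "(a', x')" "(\<alpha>, \<xi>)"] a x that h
      by (simp add: Hom_hom_gpd)
  qed
  show "(\<beta> \<box> \<alpha>) \<star> (\<eta> \<box> \<xi>) = (\<beta> \<star> \<eta>) \<box> (\<alpha> \<star> \<xi>)"
    if "\<alpha> \<in> tracks T a a'" "\<beta> \<in> tracks T a' a''" "\<xi> \<in> tracks T x x'" "\<eta> \<in> tracks T x' x''"
  proof -
    have "a' \<in> Hom T B D" "x' \<in> Hom T A B"
      using that a x tracks_Tgt by blast+
    then show ?thesis
      using is_functor_Cmp[OF F, of "(\<beta>, \<eta>)" "(a', x')" "(a'', x'')" "(\<alpha>, \<xi>)" "(a, x)"] a x that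
      by (simp add: Hom_hom_gpd)
  qed
qed

lemma Hcmp_whisker_left:
  assumes "a \<in> Hom T B D" "x \<in> Hom T A B" "\<xi> \<in> tracks T x x'" "\<eta> \<in> tracks T x' x''"
  shows "\<iota> a \<star> (\<eta> \<box> \<xi>) = \<iota> a \<star> \<eta> \<box> \<iota> a \<star> \<xi>"
  using Hcmp_interchange[OF assms(1,2) Idt_tracks Idt_tracks assms(3,4)] assms(1)
    Vcmp_Idt[OF Idt_tracks] by metis

lemma Hcmp_whisker_right:
  assumes "a \<in> Hom T B D" "x \<in> Hom T A B" "\<alpha> \<in> tracks T a a'" "\<beta> \<in> tracks T a' a''"
  shows "(\<beta> \<box> \<alpha>) \<star> \<iota> x = \<beta> \<star> \<iota> x \<box> \<alpha> \<star> \<iota> x"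
  using Hcmp_interchange[OF assms(1,2,3,4) Idt_tracks Idt_tracks] assms(2)
    Vcmp_Idt[OF Idt_tracks] by metis

end

section \<open>Addition of maps and of tracks\<close>

context left_linear_track_category
begin

lemma map_group_simps [simp]:
  "carrier (map_group T A B) = Hom T A B"
  "x \<otimes>\<^bsub>map_group T A B\<^esub> y = x \<boxplus> y"
  "\<one>\<^bsub>map_group T A B\<^esub> = Zero T A B"
  by (simp_all add: map_group_def obj_group_def)

lemma map_comm_group:
  assumes "A \<in> Obj T" "B \<in> Obj T"
  shows "comm_group (map_group T A B)"
  using hom_ab_group_gpd[OF assms] by (simp add: ab_group_gpd_def map_group_def)

abbreviation track_group :: "'o \<Rightarrow> 'o \<Rightarrow> 't monoid" where
  "track_group A B \<equiv> arr_group (hom_gpd T A B) (Zero T A B) (Tadd T)"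

lemma track_group_simps [simp]:
  "carrier (track_group A B) = Arr (hom_gpd T A B)"
  "\<alpha> \<otimes>\<^bsub>track_group A B\<^esub> \<beta> = \<alpha> \<uplus> \<beta>"
  "\<one>\<^bsub>track_group A B\<^esub> = \<iota> (Zero T A B)"
  by (simp_all add: arr_group_def)

lemma track_comm_group:
  assumes "A \<in> Obj T" "B \<in> Obj T"
  shows "comm_group (track_group A B)"
  using hom_ab_group_gpd[OF assms] by (simp add: ab_group_gpd_def)

lemma Add_in_Hom: "x \<in> Hom T A B \<Longrightarrow> y \<in> Hom T A B \<Longrightarrow> x \<boxplus> y \<in> Hom T A B"
  using comm_group.axioms(2)[OF map_comm_group, of A B] Hom_Obj[of x A B]
    monoid.m_closed[OF group.is_monoid, of "map_group T A B" x y] by simp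

lemma
  assumes x: "x \<in> Hom T A B" and y: "y \<in> Hom T A B"
  shows Tadd_Idt: "\<iota> x \<uplus> \<iota> y = \<iota> (x \<boxplus> y)"
    and Tadd_tracks: "\<alpha> \<in> tracks T x x' \<Longrightarrow> \<beta> \<in> tracks T y y' \<Longrightarrow>
      \<alpha> \<uplus> \<beta> \<in> tracks T (x \<boxplus> y) (x' \<boxplus> y')"
    and Tadd_interchange: "\<alpha> \<in> tracks T x x' \<Longrightarrow> \<alpha>' \<in> tracks T x' x'' \<Longrightarrow>
      \<beta> \<in> tracks T y y' \<Longrightarrow> \<beta>' \<in> tracks T y' y'' \<Longrightarrow>
      (\<alpha>' \<box> \<alpha>) \<uplus> (\<beta>' \<box> \<beta>) = (\<alpha>' \<uplus> \<beta>') \<box> (\<alpha> \<uplus> \<beta>)"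
proof -
  have AB: "A \<in> Obj T" "B \<in> Obj T"
    using x Hom_Obj by blast+
  let ?G = "hom_gpd T A B"
  have F: "is_functor (prod_cat ?G ?G) ?G (\<lambda>(x, y). x \<boxplus> y) (\<lambda>(\<alpha>, \<beta>). \<alpha> \<uplus> \<beta>)"
    using hom_ab_group_gpd[OF AB] by (simp add: ab_group_gpd_def)
  have h: "x \<boxplus> y \<in> Hom T A B"
    using Add_in_Hom[OF x y] .
  show "\<iota> x \<uplus> \<iota> y = \<iota> (x \<boxplus> y)"
    using is_functor_Ide[OF F, of "(x, y)"] x y by simp
  show "\<alpha> \<uplus> \<beta> \<in> tracks T (x \<boxplus> y) (x' \<boxplus> y')" if "\<alpha> \<in> tracks T x x'" "\<beta> \<in> tracks T y y'"
  proof -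
    have "x' \<in> Hom T A B" "y' \<in> Hom T A B"
      using that x y tracks_Tgt by blast+
    then show ?thesis
      using is_functor_Hom[OF F, of "(x, y)" "(x', y')" "(\<alpha>, \<beta>)"] x y that h
      by (simp add: Hom_hom_gpd)
  qed
  show "(\<alpha>' \<box> \<alpha>) \<uplus> (\<beta>' \<box> \<beta>) = (\<alpha>' \<uplus> \<beta>') \<box> (\<alpha> \<uplus> \<beta>)"
    if "\<alpha> \<in> tracks T x x'" "\<alpha>' \<in> tracks T x' x''" "\<beta> \<in> tracks T y y'" "\<beta>' \<in> tracks T y' y''"
  proof -
    have "x' \<in> Hom T A B" "y' \<in> Hom T A B"
      using that x y tracks_Tgt by blast+
    then show ?thesis
      using is_functor_Cmp[OF F, of "(\<alpha>', \<beta>')" "(x', y')" "(x'', y'')" "(\<alpha>, \<beta>)" "(x, y)"] x y that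
      by (simp add: Hom_hom_gpd)
  qed
qed

lemma
  assumes x: "x \<in> Hom T A B"
  shows Zero_Add: "Zero T A B \<boxplus> x = x"
    and Add_comm: "y \<in> Hom T A B \<Longrightarrow> x \<boxplus> y = y \<boxplus> x"
    and Add_assoc: "y \<in> Hom T A B \<Longrightarrow> z \<in> Hom T A B \<Longrightarrow> (x \<boxplus> y) \<boxplus> z = x \<boxplus> (y \<boxplus> z)"
    and Add_inverse: "\<exists>y\<in>Hom T A B. x \<boxplus> y = Zero T A B"
    and Add_right_cancel: "y \<in> Hom T A B \<Longrightarrow> z \<in> Hom T A B \<Longrightarrow> y \<boxplus> x = z \<boxplus> x \<Longrightarrow> y = z"
proof -
  interpret comm_group "map_group T A B"
    using map_comm_group Hom_Obj[OF x] by blast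
  show "Zero T A B \<boxplus> x = x"
    using l_one[of x] x by simp
  show "x \<boxplus> y = y \<boxplus> x" if "y \<in> Hom T A B"
    using m_comm[of x y] x that by simp
  show "(x \<boxplus> y) \<boxplus> z = x \<boxplus> (y \<boxplus> z)" if "y \<in> Hom T A B" "z \<in> Hom T A B"
    using m_assoc[of x y z] x that by simp
  show "\<exists>y\<in>Hom T A B. x \<boxplus> y = Zero T A B"
    using r_inv_ex[of x] x by simp
  show "y = z" if "y \<in> Hom T A B" "z \<in> Hom T A B" "y \<boxplus> x = z \<boxplus> x"
    using right_cancel[of x y z] x that by simp
qed

lemma
  assumes x: "\<alpha> \<in> Arr (hom_gpd T A B)"
  shows Zero_Tadd: "\<iota> (Zero T A B) \<uplus> \<alpha> = \<alpha>"
    and Tadd_comm: "\<beta> \<in> Arr (hom_gpd T A B) \<Longrightarrow> \<alpha> \<uplus> \<beta> = \<beta> \<uplus> \<alpha>"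
    and Tadd_Arr: "\<beta> \<in> Arr (hom_gpd T A B) \<Longrightarrow> \<alpha> \<uplus> \<beta> \<in> Arr (hom_gpd T A B)"
    and Tadd_assoc: "\<beta> \<in> Arr (hom_gpd T A B) \<Longrightarrow> \<gamma> \<in> Arr (hom_gpd T A B) \<Longrightarrow>
      (\<alpha> \<uplus> \<beta>) \<uplus> \<gamma> = \<alpha> \<uplus> (\<beta> \<uplus> \<gamma>)"
    and Tadd_inverse: "\<exists>\<beta>\<in>Arr (hom_gpd T A B). \<alpha> \<uplus> \<beta> = \<iota> (Zero T A B)"
    and Tadd_right_cancel: "\<beta> \<in> Arr (hom_gpd T A B) \<Longrightarrow> \<gamma> \<in> Arr (hom_gpd T A B) \<Longrightarrow>
      \<beta> \<uplus> \<alpha> = \<gamma> \<uplus> \<alpha> \<Longrightarrow> \<beta> = \<gamma>"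
proof -
  interpret comm_group "track_group A B"
    using track_comm_group x Hom_Obj by (auto simp: Arr_hom_gpd_iff)
  show "\<iota> (Zero T A B) \<uplus> \<alpha> = \<alpha>"
    using l_one[of \<alpha>] x by simp
  show "\<alpha> \<uplus> \<beta> = \<beta> \<uplus> \<alpha>" if "\<beta> \<in> Arr (hom_gpd T A B)"
    using m_comm[of \<alpha> \<beta>] x that by simp
  show "\<alpha> \<uplus> \<beta> \<in> Arr (hom_gpd T A B)" if "\<beta> \<in> Arr (hom_gpd T A B)"
    using m_closed[of \<alpha> \<beta>] x that by simp
  show "(\<alpha> \<uplus> \<beta>) \<uplus> \<gamma> = \<alpha> \<uplus> (\<beta> \<uplus> \<gamma>)"
    if "\<beta> \<in> Arr (hom_gpd T A B)" "\<gamma> \<in> Arr (hom_gpd T A B)"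
    using m_assoc[of \<alpha> \<beta> \<gamma>] x that by simp
  show "\<exists>\<beta>\<in>Arr (hom_gpd T A B). \<alpha> \<uplus> \<beta> = \<iota> (Zero T A B)"
    using r_inv_ex[of \<alpha>] x by simp
  show "\<beta> = \<gamma>"
    if "\<beta> \<in> Arr (hom_gpd T A B)" "\<gamma> \<in> Arr (hom_gpd T A B)" "\<beta> \<uplus> \<alpha> = \<gamma> \<uplus> \<alpha>"
    using right_cancel[of \<alpha> \<beta> \<gamma>] x that by simp
qed

text \<open>Needed where a sum of left factors meets a sum of right arguments, so that four tracks
  have to be regrouped.\<close>

lemma Tadd_middle_swap:
  assumes "\<alpha> \<in> Arr (hom_gpd T A B)" "\<alpha>' \<in> Arr (hom_gpd T A B)"
    "\<beta> \<in> Arr (hom_gpd T A B)" "\<beta>' \<in> Arr (hom_gpd T A B)"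
  shows "(\<alpha> \<uplus> \<alpha>') \<uplus> (\<beta> \<uplus> \<beta>') = (\<alpha> \<uplus> \<beta>) \<uplus> (\<alpha>' \<uplus> \<beta>')"
proof -
  have "\<alpha>' \<uplus> (\<beta> \<uplus> \<beta>') = \<beta> \<uplus> (\<alpha>' \<uplus> \<beta>')"
    using Tadd_assoc[of \<alpha>' A B \<beta> \<beta>'] Tadd_assoc[of \<beta> A B \<alpha>' \<beta>'] Tadd_comm[of \<alpha>' A B \<beta>] assms
    by simp
  then show ?thesis
    using assms Tadd_Arr by (simp add: Tadd_assoc)
qed

end

section \<open>Free categories and linearizations\<close>

text \<open>The homomorphism from a free abelian group to \<open>G\<close> that extends
  \<open>h\<close>, in multiplicative notation. It frees the formula behind
  \<open>linear_extension\<close> from the endpoints, so that it can also be evaluated in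
  \<open>lift_group\<close>.\<close>

definition frag_prod :: "('m, 'z) monoid_scheme \<Rightarrow> ('a \<Rightarrow> 'm) \<Rightarrow> ('a \<Rightarrow>\<^sub>0 int) \<Rightarrow> 'm" where
  "frag_prod G h c = finprod G (\<lambda>w. h w [^]\<^bsub>G\<^esub> Poly_Mapping.lookup c w) (Poly_Mapping.keys c)"

lemma linear_extension_eq_frag_prod:
  "linear_extension grp fo h x = frag_prod (grp (fo (mdom x)) (fo (mcod x))) h (rep x)"
  by (simp add: linear_extension_def frag_prod_def)

context comm_group
begin

text \<open>Outside the support the exponent is zero and the factor is the unit, so a larger finite
  set may serve as index set.\<close>

lemma frag_prod_superset:
  assumes "h \<in> S \<rightarrow> carrier G" "finite K" "Poly_Mapping.keys c \<subseteq> K" "K \<subseteq> S"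
  shows "frag_prod G h c = finprod G (\<lambda>w. h w [^] Poly_Mapping.lookup c w) K"
  unfolding frag_prod_def using assms
  by (intro finprod_mono_neutral_cong_left) (auto simp: in_keys_iff)

lemma frag_prod_0 [simp]: "frag_prod G h 0 = \<one>"
  by (simp add: frag_prod_def)

lemma frag_prod_of:
  assumes "h w \<in> carrier G"
  shows "frag_prod G h (frag_of w) = h w"
  using assms by (simp add: frag_prod_def)

lemma frag_prod_closed:
  assumes "h \<in> S \<rightarrow> carrier G" "Poly_Mapping.keys c \<subseteq> S"
  shows "frag_prod G h c \<in> carrier G"
  unfolding frag_prod_def using assms by (intro finprod_closed) auto

lemma frag_prod_add:
  assumes h: "h \<in> S \<rightarrow> carrier G" and c: "Poly_Mapping.keys c \<subseteq> S" and d: "Poly_Mapping.keys d \<subseteq> S"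
  shows "frag_prod G h (c + d) = frag_prod G h c \<otimes> frag_prod G h d"
proof -
  \<comment> \<open>Coefficients may cancel in \<open>c + d\<close>, so all three products are taken
    over the union of the two supports.\<close>
  let ?K = "Poly_Mapping.keys c \<union> Poly_Mapping.keys d"
  have K: "finite ?K" "?K \<subseteq> S" "Poly_Mapping.keys (c + d) \<subseteq> ?K"
    using c d keys_add[of c d] by auto
  have hK: "\<And>w. w \<in> ?K \<Longrightarrow> h w \<in> carrier G"
    using h K by auto
  have "frag_prod G h (c + d) = finprod G (\<lambda>w. h w [^] Poly_Mapping.lookup (c + d) w) ?K"
    using frag_prod_superset[OF h K(1,3,2)] .
  also have "\<dots> = finprod G (\<lambda>w. h w [^] Poly_Mapping.lookup c w \<otimes> h w [^] Poly_Mapping.lookup d w) ?K"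
    using hK by (intro finprod_cong') (auto simp: lookup_add int_pow_mult)
  also have "\<dots> = finprod G (\<lambda>w. h w [^] Poly_Mapping.lookup c w) ?K
      \<otimes> finprod G (\<lambda>w. h w [^] Poly_Mapping.lookup d w) ?K"
    using hK by (intro finprod_multf) auto
  also have "\<dots> = frag_prod G h c \<otimes> frag_prod G h d"
    using frag_prod_superset[OF h K(1) _ K(2), of c] frag_prod_superset[OF h K(1) _ K(2), of d] by simp
  finally show ?thesis .
qed

end

section \<open>The integral linearization of a category\<close>

lemma linear_cat_simps [simp]:
  "Obj (linear_cat C) = Obj C"
  "Dom (linear_cat C) = mdom"
  "Cod (linear_cat C) = mcod"
  "Ide (linear_cat C) A = Mor A A (Poly_Mapping.single (Ide C A) 1)"
  by (simp_all add: linear_cat_def)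

lemma Hom_linear_cat_iff:
  fixes x :: "('o, 'a \<Rightarrow>\<^sub>0 'r::comm_ring_1) mor"
  shows "x \<in> Hom (linear_cat C) A B \<longleftrightarrow>
    mdom x = A \<and> mcod x = B \<and> A \<in> Obj C \<and> B \<in> Obj C \<and> Poly_Mapping.keys (rep x) \<subseteq> Hom C A B"
  unfolding Hom_def[of "linear_cat C :: ('o, ('o, 'a \<Rightarrow>\<^sub>0 'r) mor) cat"]
  by (auto simp: linear_cat_def)

text \<open>The double sum becomes a nested \<open>frag_extend\<close>; bilinearity of composition
  is then inherited from the additivity of \<open>frag_extend\<close>.\<close>

lemma Cmp_linear_cat:
  fixes x y :: "('o, 'a \<Rightarrow>\<^sub>0 int) mor"
  shows "x \<cdot>\<^bsub>linear_cat C\<^esub> y = Mor (mdom y) (mcod x)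
    (frag_extend (\<lambda>u. frag_extend (\<lambda>v. frag_of (u \<cdot>\<^bsub>C\<^esub> v)) (rep y)) (rep x))"
proof -
  have "frag_cmul k (Poly_Mapping.single w l) = Poly_Mapping.single w (k * l)" for w :: 'a and k l
    by (intro poly_mapping_eqI) (simp add: lookup_single when_def)
  then show ?thesis
    by (simp add: linear_cat_def frag_extend_def frag_cmul_sum)
qed

lemma mor_eqI: "mdom x = mdom y \<Longrightarrow> mcod x = mcod y \<Longrightarrow> rep x = rep y \<Longrightarrow> x = y"
  by (cases x; cases y) simp

lemma mdom_lin_add [simp]: "mdom (lin_add x y) = mdom x"
  and mcod_lin_add [simp]: "mcod (lin_add x y) = mcod x"
  and rep_lin_add [simp]: "rep (lin_add x y) = rep x + rep y"
  by (simp_all add: lin_add_def)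

lemma lin_add_in_Hom:
  assumes "x \<in> Hom (linear_cat C) A B" "y \<in> Hom (linear_cat C) A B"
  shows "lin_add x y \<in> Hom (linear_cat C) A B"
  using assms keys_add[of "rep x" "rep y"] unfolding Hom_linear_cat_iff by auto

lemma zero_in_Hom_linear_cat:
  "A \<in> Obj C \<Longrightarrow> B \<in> Obj C \<Longrightarrow> Mor A B 0 \<in> Hom (linear_cat C) A B"
  by (simp add: Hom_linear_cat_iff)

text \<open>Discharges the \<open>cancel\<close> case of the induction below: an additive identity
  known for \<open>y + z\<close> and for \<open>z\<close> descends to \<open>y\<close>.\<close>

lemma lin_add_right_cancel:
  assumes "x \<in> Hom (linear_cat C) A B" "y \<in> Hom (linear_cat C) A B" "lin_add x z = lin_add y z"
  shows "x = y"
  using assms by (auto simp: Hom_linear_cat_iff lin_add_def intro: mor_eqI)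

lemma (in category) lin_of_in_Hom:
  "w \<in> Hom C A B \<Longrightarrow> (lin_of C w :: ('o, 'a \<Rightarrow>\<^sub>0 int) mor) \<in> Hom (linear_cat C) A B"
  using Hom_Obj by (auto simp: lin_of_def Hom_linear_cat_iff) (auto simp: Hom_def)

text \<open>The last premise replaces closure under differences, as \<open>y = (y + z) - z\<close>.\<close>

lemma linear_cat_induct [consumes 1, case_names zero lin_of cancel]:
  fixes x :: "('o, 'a \<Rightarrow>\<^sub>0 int) mor"
  assumes x: "x \<in> Hom (linear_cat C) A B"
    and zero: "P (Mor A B 0)"
    and of: "\<And>w. w \<in> Hom C A B \<Longrightarrow> P (lin_of C w)"
    and cancel: "\<And>y z. y \<in> Hom (linear_cat C) A B \<Longrightarrow> z \<in> Hom (linear_cat C) A B \<Longrightarrow>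
      P (lin_add y z) \<Longrightarrow> P z \<Longrightarrow> P y"
  shows "P x"
proof -
  have AB: "A \<in> Obj C" "B \<in> Obj C" and k: "Poly_Mapping.keys (rep x) \<subseteq> Hom C A B"
    and x': "x = Mor A B (rep x)"
    using x by (auto simp: Hom_linear_cat_iff mor_eqI)
  have "Poly_Mapping.keys c \<subseteq> Hom C A B \<Longrightarrow> P (Mor A B c)" for c :: "'a \<Rightarrow>\<^sub>0 int"
  proof -
    assume "Poly_Mapping.keys c \<subseteq> Hom C A B"
    \<comment> \<open>The support condition is carried inside the induction predicate, because the
      \<open>diff\<close> case of \<open>frag_induction\<close> offers nothing but the predicate for
      the two parts.\<close>
    then have "Poly_Mapping.keys c \<subseteq> Hom C A B \<and> P (Mor A B c)"
    proof (induction c rule: frag_induction)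
      case zero
      then show ?case using assms(2) by simp
    next
      case (one w)
      then show ?case using of[of w] by (auto simp: lin_of_def Hom_def)
    next
      case (diff a b)
      have "Poly_Mapping.keys (a - b) \<subseteq> Hom C A B"
        using keys_diff[of a b] diff by auto
      then show ?case
        using cancel[of "Mor A B (a - b)" "Mor A B b"] diff AB
        by (simp add: Hom_linear_cat_iff lin_add_def)
    qed
    then show ?thesis by blast
  qed
  then show ?thesis using k x' by metis
qed

lemma Cmp_lin_add_left:
  fixes x x' y :: "('o, 'a \<Rightarrow>\<^sub>0 int) mor"
  shows "lin_add x x' \<cdot>\<^bsub>linear_cat C\<^esub> y = lin_add (x \<cdot>\<^bsub>linear_cat C\<^esub> y) (x' \<cdot>\<^bsub>linear_cat C\<^esub> y)"
  by (simp add: Cmp_linear_cat lin_add_def frag_extend_add)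

lemma frag_extend_add_fun: "frag_extend (\<lambda>u. f u + g u) c = frag_extend f c + frag_extend g c"
  by (simp add: frag_extend_def frag_cmul_distrib2 sum.distrib)

lemma Cmp_lin_add_right:
  fixes x y y' :: "('o, 'a \<Rightarrow>\<^sub>0 int) mor"
  assumes "mdom y = mdom y'"
  shows "x \<cdot>\<^bsub>linear_cat C\<^esub> lin_add y y' = lin_add (x \<cdot>\<^bsub>linear_cat C\<^esub> y) (x \<cdot>\<^bsub>linear_cat C\<^esub> y')"
  using assms by (simp add: Cmp_linear_cat lin_add_def frag_extend_add frag_extend_add_fun)

lemma frag_extend_zero_fun [simp]: "frag_extend (\<lambda>u. 0) c = 0"
  by (simp add: frag_extend_eq_0)

lemma Cmp_zero_left:
  "(Mor B D (0 :: 'a \<Rightarrow>\<^sub>0 int)) \<cdot>\<^bsub>linear_cat C\<^esub> y = Mor (mdom y) D 0"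
  by (simp add: Cmp_linear_cat)

lemma Cmp_zero_right:
  "x \<cdot>\<^bsub>linear_cat C\<^esub> (Mor A B (0 :: 'a \<Rightarrow>\<^sub>0 int)) = Mor A (mcod x) 0"
  by (simp add: Cmp_linear_cat)

lemma (in category) Cmp_lin_of:
  assumes "u \<in> Hom C B D" "v \<in> Hom C A B"
  shows "(lin_of C u :: ('o, 'a \<Rightarrow>\<^sub>0 int) mor) \<cdot>\<^bsub>linear_cat C\<^esub> lin_of C v = lin_of C (u \<cdot> v)"
  using assms Cmp_in_Hom[OF assms] by (simp add: Cmp_linear_cat lin_of_def Hom_def)

lemma (in category) Ide_linear_cat:
  "A \<in> Obj C \<Longrightarrow> (Ide (linear_cat C) A :: ('o, 'a \<Rightarrow>\<^sub>0 int) mor) = lin_of C (Ide C A)"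
  using Ide_in_Hom[of A] by (simp add: lin_of_def Hom_def)

lemma (in category) Cmp_linear_cat_in_Hom:
  fixes x y :: "('o, 'a \<Rightarrow>\<^sub>0 int) mor"
  assumes "x \<in> Hom (linear_cat C) B D" "y \<in> Hom (linear_cat C) A B"
  shows "x \<cdot>\<^bsub>linear_cat C\<^esub> y \<in> Hom (linear_cat C) A D"
proof -
  have "Poly_Mapping.keys (rep (x \<cdot>\<^bsub>linear_cat C\<^esub> y)) \<subseteq>
      (\<Union>u\<in>Poly_Mapping.keys (rep x). \<Union>v\<in>Poly_Mapping.keys (rep y). {u \<cdot> v})"
    using keys_frag_extend unfolding Cmp_linear_cat mor.sel
    by (force dest: subsetD[OF keys_frag_extend] simp: keys_frag_of)
  also have "\<dots> \<subseteq> Hom C A D"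
    using assms Cmp_in_Hom unfolding Hom_linear_cat_iff by blast
  finally show ?thesis
    using assms by (simp add: Hom_linear_cat_iff Cmp_linear_cat)
qed

text \<open>Both sides of each equational axiom are additive in each variable, so the axiom
  propagates from basis morphisms, where it is the axiom of \<open>C\<close>. Associativity takes
  one induction per factor; the factors already treated stay basis morphisms in the inner
  inductions.\<close>

lemma (in category) category_linear_cat:
  "category (linear_cat C :: ('o, ('o, 'a \<Rightarrow>\<^sub>0 int) mor) cat)"
proof -
  let ?L = "linear_cat C :: ('o, ('o, 'a \<Rightarrow>\<^sub>0 int) mor) cat"
  have id: "Ide ?L A \<in> Hom ?L A A" if "A \<in> Obj C" for A
    using lin_of_in_Hom[OF Ide_in_Hom[OF that]] Ide_linear_cat[OF that] by simp
  have r: "x \<cdot>\<^bsub>?L\<^esub> Ide ?L A = x" if "x \<in> Hom ?L A B" for x A B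
    using that
  proof (induction x rule: linear_cat_induct)
    case zero
    then show ?case by (simp add: Cmp_zero_left)
  next
    case (lin_of w)
    then show ?case
      using Cmp_lin_of[OF lin_of Ide_in_Hom] Ide_linear_cat[of A] Hom_Obj[of w A B] Cmp_Ide by simp
  next
    case (cancel y z)
    then have A: "A \<in> Obj C" by (simp add: Hom_linear_cat_iff)
    show ?case
      using lin_add_right_cancel[OF Cmp_linear_cat_in_Hom[OF cancel(1) id[OF A]] cancel(1), of z]
        cancel(3,4) by (metis Cmp_lin_add_left)
  qed
  have l: "Ide ?L B \<cdot>\<^bsub>?L\<^esub> x = x" if "x \<in> Hom ?L A B" for x A B
    using that
  proof (induction x rule: linear_cat_induct)
    case zero
    then show ?case by (simp add: Cmp_zero_right)
  next
    case (lin_of w)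
    then show ?case
      using Cmp_lin_of[OF Ide_in_Hom lin_of] Ide_linear_cat[of B] Hom_Obj[of w A B] Ide_Cmp by simp
  next
    case (cancel y z)
    then have B: "B \<in> Obj C" "mdom y = mdom z" by (simp_all add: Hom_linear_cat_iff)
    show ?case
      using lin_add_right_cancel[OF Cmp_linear_cat_in_Hom[OF id[OF B(1)] cancel(1)] cancel(1), of z]
        cancel(3,4) Cmp_lin_add_right[OF B(2)] by metis
  qed
  have assoc: "(x \<cdot>\<^bsub>?L\<^esub> y) \<cdot>\<^bsub>?L\<^esub> z = x \<cdot>\<^bsub>?L\<^esub> (y \<cdot>\<^bsub>?L\<^esub> z)"
    if x: "x \<in> Hom ?L D E" and y: "y \<in> Hom ?L B D" and z: "z \<in> Hom ?L A B" for x y z A B D E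
    using x
  proof (induction x rule: linear_cat_induct)
    case zero
    show ?case by (simp add: Cmp_zero_left Cmp_linear_cat)
  next
    case (cancel a b)
    note H = Cmp_linear_cat_in_Hom
    show ?case
      using lin_add_right_cancel[OF H[OF H[OF cancel(1) y] z] H[OF cancel(1) H[OF y z]]] cancel(3,4)
      by (simp add: Cmp_lin_add_left)
  next
    case (lin_of u)
    note u = this lin_of_in_Hom[OF this]
    show ?case
      using y
    proof (induction y rule: linear_cat_induct)
      case zero
      show ?case by (simp add: Cmp_zero_left Cmp_zero_right Cmp_linear_cat)
    next
      case (cancel a b)
      note H = Cmp_linear_cat_in_Hom
      have "mdom a = mdom b" "mdom (a \<cdot>\<^bsub>?L\<^esub> z) = mdom (b \<cdot>\<^bsub>?L\<^esub> z)"
        using cancel by (simp_all add: Hom_linear_cat_iff Cmp_linear_cat)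
      then show ?case
        using lin_add_right_cancel[OF H[OF H[OF u(2) cancel(1)] z] H[OF u(2) H[OF cancel(1) z]]]
          cancel(3,4) by (simp add: Cmp_lin_add_left Cmp_lin_add_right)
    next
      case (lin_of v)
      note v = this lin_of_in_Hom[OF this]
      show ?case
        using z
      proof (induction z rule: linear_cat_induct)
        case zero
        show ?case by (simp add: Cmp_zero_right Cmp_linear_cat)
      next
        case (cancel a b)
        note H = Cmp_linear_cat_in_Hom
        have "mdom a = mdom b"
          "mdom (lin_of C v \<cdot>\<^bsub>?L\<^esub> a) = mdom (lin_of C v \<cdot>\<^bsub>?L\<^esub> b)"
          using cancel by (simp_all add: Hom_linear_cat_iff Cmp_linear_cat)
        then show ?case
          using lin_add_right_cancel[OF H[OF H[OF u(2) v(2)] cancel(1)] H[OF u(2) H[OF v(2) cancel(1)]]]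
            cancel(3,4) by (simp add: Cmp_lin_add_right)
      next
        case (lin_of w)
        show ?case
          using Cmp_lin_of[OF u(1) v(1)] Cmp_lin_of[OF v(1) lin_of]
            Cmp_lin_of[OF u(1) Cmp_in_Hom[OF v(1) lin_of]]
            Cmp_lin_of[OF Cmp_in_Hom[OF u(1) v(1)] lin_of] Cmp_assoc[OF u(1) v(1) lin_of]
          by simp
      qed
    qed
  qed
  show ?thesis
  proof
    show "Dom ?L x \<in> Obj ?L" "Cod ?L x \<in> Obj ?L" if "x \<in> Arr ?L" for x
      using that by (auto simp: linear_cat_def)
  qed (use id l r assoc Cmp_linear_cat_in_Hom in auto)
qed

section \<open>The free category on a graph and the evaluation of words\<close>

lemma free_cat_simps [simp]:
  "Obj (free_cat E) = verts E"
  "Ide (free_cat E) v = Mor v v []"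
  "x \<cdot>\<^bsub>free_cat E\<^esub> y = Mor (mdom y) (mcod x) (rep y @ rep x)"
  by (simp_all add: free_cat_def)

lemma Hom_free_cat_iff:
  "w \<in> Hom (free_cat E) A B \<longleftrightarrow> mdom w = A \<and> mcod w = B \<and> pre_digraph.awalk E A (rep w) B"
  by (auto simp: free_cat_def Hom_def)

lemma (in wf_digraph) category_free_cat: "category (free_cat G)"
proof
  show "Dom (free_cat G) w \<in> Obj (free_cat G)" "Cod (free_cat G) w \<in> Obj (free_cat G)"
    if "w \<in> Arr (free_cat G)" for w
    using that awalk_hd_in_verts awalk_last_in_verts by (auto simp: free_cat_def)
qed (auto simp: Hom_free_cat_iff awalk_Nil_iff intro: mor_eqI)

context category
begin

lemma walk_eval_in_Hom:
  assumes E: "wf_digraph E" and m: "graph_morphism E (under_graph C) fv fe"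
    and p: "pre_digraph.awalk E v p v'"
  shows "walk_eval E C fv fe v p \<in> Hom C (fv v) (fv v')"
proof -
  interpret wf_digraph E by fact
  show ?thesis
    using p
  proof (induction p arbitrary: v)
    case Nil
    then have "v = v'" "v' \<in> verts E" unfolding awalk_Nil_iff by auto
    then show ?case
      using m Ide_in_Hom[of "fv v'"] by (auto simp: graph_morphism_def under_graph_def)
  next
    case (Cons e p)
    then have e: "e \<in> arcs E" "v = tail E e" "awalk (head E e) p v'"
      by (simp_all add: awalk_Cons_iff)
    have "fe e \<in> Hom C (fv v) (fv (head E e))"
      using m e(1,2) by (auto simp: graph_morphism_def under_graph_def Hom_def)
    then show ?case
      using Cmp_in_Hom[OF Cons.IH[OF e(3)]] by simp
  qed
qed

text \<open>Words are stored in order of traversal while composition is written the other way, so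
  the later word becomes the left factor. The recursion removes the arc traversed first, which is
  the rightmost factor; hence the starting vertex varies in the induction.\<close>

lemma walk_eval_append:
  assumes E: "wf_digraph E" and m: "graph_morphism E (under_graph C) fv fe"
    and p: "pre_digraph.awalk E v p v'" and q: "pre_digraph.awalk E v' q v''"
  shows "walk_eval E C fv fe v (p @ q) = walk_eval E C fv fe v' q \<cdot> walk_eval E C fv fe v p"
proof -
  interpret wf_digraph E by fact
  show ?thesis
    using p
  proof (induction p arbitrary: v)
    case Nil
    then have "v = v'" by (simp add: awalk_Nil_iff)
    then show ?case
      using Cmp_Ide[OF walk_eval_in_Hom[OF E m q]] by simp
  next
    case (Cons e p)
    then have e: "e \<in> arcs E" "v = tail E e" "awalk (head E e) p v'"
      by (simp_all add: awalk_Cons_iff)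
    have "fe e \<in> Hom C (fv v) (fv (head E e))"
      using m e(1,2) by (auto simp: graph_morphism_def under_graph_def Hom_def)
    then show ?case
      using Cons.IH[OF e(3)] Cmp_assoc[OF walk_eval_in_Hom[OF E m q] walk_eval_in_Hom[OF E m e(3)]]
      by simp
  qed
qed

end

section \<open>Tracks additive up to linearity tracks\<close>

text \<open>The same constant as \<open>linear_cat\<close>; only the type fixes the coefficients to
  be integers.\<close>

abbreviation (input) int_cat :: "('o, 'a, 'z) cat_scheme \<Rightarrow> ('o, ('o, 'a \<Rightarrow>\<^sub>0 int) mor) cat" where
  "int_cat C \<equiv> linear_cat C"

section \<open>Normalization of linearity tracks and the twisted sum\<close>

context linearity_tracks
begin

text \<open>Supplies the neutral element of \<open>lift_group\<close>. For \<open>z = 0\<close>,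
  precomposition with a zero map turns the track into an identity. Using this in the cocycle at two
  zeros and \<open>z\<close> leaves \<open>\<iota> (a \<cdot> z) \<box> L = L \<box> L\<close> for
  the track in question, and cancellation in the groupoid finishes.\<close>

lemma lin_Zero:
  assumes a: "a \<in> Hom T A B" and z: "z \<in> Hom T X A"
  shows "L a (Zero T X A) z = \<iota> (a \<cdot> z)"
proof -
  have Ob: "X \<in> Obj T" "A \<in> Obj T" "B \<in> Obj T"
    using a z Hom_Obj by blast+
  define o' where "o' = Zero T X A"
  have o': "o' \<in> Hom T X A" and oX: "Zero T X X \<in> Hom T X X"
    using Zero_in_Hom Ob unfolding o'_def by auto
  \<comment> \<open>The zero map \<open>o'\<close> equals itself precomposed with the zero
    endomorphism of \<open>X\<close>, which makes \<open>lin_precomp\<close> applicable.\<close>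
  have "L a o' o' = L a (o' \<cdot> Zero T X X) (o' \<cdot> Zero T X X)"
    using Cmp_Zero[OF o' Ob(1)] by (simp add: o'_def)
  also have "\<dots> = L a o' o' \<star> \<iota> (Zero T X X)"
    using lin_precomp[OF a o' o' oX] .
  also have "\<dots> = \<iota> (Zero T X B)"
    using Hcmp_Zero[OF tracks_Arr[OF lin_track[OF a o' o']]] Cmp_in_Hom[OF a] Add_in_Hom[OF o' o'] Ob
    by simp
  finally have LZ: "L a o' o' = \<iota> (Zero T X B)" .
  have az: "a \<cdot> z \<in> Hom T X B" and zz: "o' \<boxplus> z = z" "o' \<boxplus> o' = o'" "a \<cdot> o' = Zero T X B"
    using Cmp_in_Hom[OF a z] Zero_Add[OF z] Zero_Add[OF o'] Cmp_Zero[OF a Ob(1)] by (simp_all add: o'_def)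
  have t: "L a o' z \<in> tracks T (a \<cdot> z) (a \<cdot> z)"
    using lin_track[OF a o' z] Zero_Add[OF az] zz by simp
  have "(\<iota> (Zero T X B) \<uplus> \<iota> (a \<cdot> z)) \<box> L a o' z = (\<iota> (Zero T X B) \<uplus> L a o' z) \<box> L a o' z"
    using lin_cocycle[OF a o' o' z] LZ zz by simp
  then have "\<iota> (a \<cdot> z) \<box> L a o' z = L a o' z \<box> L a o' z"
    using Zero_Tadd[OF Idt_Arr[OF az]] Zero_Tadd[OF tracks_Arr[OF t az]] by simp
  then have "L a o' z = \<iota> (a \<cdot> z)"
    using Vcmp_right_cancel[OF Idt_tracks[OF az] t t] by simp
  then show ?thesis by (simp add: o'_def)
qed

text \<open>Since the identity map is its own square, \<open>lin_comp\<close> makes this track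
  idempotent.\<close>

lemma lin_Ide:
  assumes x: "x \<in> Hom T X A" and y: "y \<in> Hom T X A"
  shows "L (Ide T A) x y = \<iota> (x \<boxplus> y)"
proof -
  have xy: "x \<boxplus> y \<in> Hom T X A" and i: "Ide T A \<in> Hom T A A"
    using Add_in_Hom[OF x y] Ide_in_Hom Hom_Obj[OF x] by auto
  have t: "L (Ide T A) x y \<in> tracks T (x \<boxplus> y) (x \<boxplus> y)"
    using lin_track[OF i x y] Ide_Cmp[OF x] Ide_Cmp[OF y] Ide_Cmp[OF xy] by simp
  have "L (Ide T A) x y = L (Ide T A) x y \<box> L (Ide T A) x y"
    using lin_comp[OF i i x y] Ide_Cmp[OF x] Ide_Cmp[OF y] Ide_Cmp[OF i] Ide_Hcmp[OF tracks_Arr[OF t xy]]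
    by simp
  then show ?thesis
    using Vcmp_idem[OF t] by simp
qed

text \<open>The target of a twisted sum is the plain sum of the targets; only the source needs the
  correction.\<close>

lemma lin_sum_tracks:
  assumes "a \<in> Hom T A B" "m \<in> Hom T X A" "m' \<in> Hom T X A"
    "\<gamma> \<in> tracks T (a \<cdot> m) n" "\<gamma>' \<in> tracks T (a \<cdot> m') n'"
  shows "(\<gamma> \<uplus> \<gamma>') \<box> L a m m' \<in> tracks T (a \<cdot> (m \<boxplus> m')) (n \<boxplus> n')"
  using Vcmp_tracks[OF Tadd_tracks[OF Cmp_in_Hom Cmp_in_Hom assms(4,5)] lin_track] assms by blast

text \<open>Both bracketings are brought to a threefold sum of tracks after a threefold linearity
  track, where \<open>lin_cocycle\<close> matches them. Note that \<open>\<uplus>\<close> binds more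
  tightly than \<open>\<box>\<close>.\<close>

lemma lin_sum_assoc:
  assumes a: "a \<in> Hom T A B" and m: "m \<in> Hom T X A" "m' \<in> Hom T X A" "m'' \<in> Hom T X A"
    and t: "\<gamma> \<in> tracks T (a \<cdot> m) n" "\<gamma>' \<in> tracks T (a \<cdot> m') n'" "\<gamma>'' \<in> tracks T (a \<cdot> m'') n''"
  shows "((\<gamma> \<uplus> \<gamma>') \<box> L a m m') \<uplus> \<gamma>'' \<box> L a (m \<boxplus> m') m'' =
    \<gamma> \<uplus> ((\<gamma>' \<uplus> \<gamma>'') \<box> L a m' m'') \<box> L a m (m' \<boxplus> m'')"
proof -
  note am = Cmp_in_Hom[OF a m(1)] Cmp_in_Hom[OF a m(2)] Cmp_in_Hom[OF a m(3)]
  note mm = Add_in_Hom[OF m(1,2)] Add_in_Hom[OF m(2,3)]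
  note amm = Cmp_in_Hom[OF a mm(1)] Cmp_in_Hom[OF a mm(2)]
  note A = Tadd_tracks[OF am(1,2) t(1,2)] Tadd_tracks[OF am(2,3) t(2,3)]
  note LT = lin_track[OF a m(1,2)] lin_track[OF a m(2,3)]
  note LL = lin_track[OF a mm(1) m(3)] lin_track[OF a m(1) mm(2)]
  \<comment> \<open>Writing \<open>\<gamma>''\<close> as its composite with an identity track lets
    the exchange law pull the inner linearity track out of the sum.\<close>
  have "((\<gamma> \<uplus> \<gamma>') \<box> L a m m') \<uplus> \<gamma>'' = ((\<gamma> \<uplus> \<gamma>') \<uplus> \<gamma>'') \<box> (L a m m' \<uplus> \<iota> (a \<cdot> m''))"
    using Tadd_interchange[OF amm(1) am(3) LT(1) A(1) Idt_tracks[OF am(3)] t(3)] Vcmp_Idt[OF t(3)] by simp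
  then have "((\<gamma> \<uplus> \<gamma>') \<box> L a m m') \<uplus> \<gamma>'' \<box> L a (m \<boxplus> m') m'' =
      ((\<gamma> \<uplus> \<gamma>') \<uplus> \<gamma>'') \<box> ((L a m m' \<uplus> \<iota> (a \<cdot> m'')) \<box> L a (m \<boxplus> m') m'')"
    using Vcmp_assoc[OF Tadd_tracks[OF Add_in_Hom[OF am(1,2)] am(3) A(1) t(3)]
        Tadd_tracks[OF amm(1) am(3) LT(1) Idt_tracks[OF am(3)]] LL(1)] by simp
  also have "\<dots> = (\<gamma> \<uplus> (\<gamma>' \<uplus> \<gamma>'')) \<box> ((\<iota> (a \<cdot> m) \<uplus> L a m' m'') \<box> L a m (m' \<boxplus> m''))"
    using lin_cocycle[OF a m] Tadd_assoc[OF tracks_Arr[OF t(1) am(1)] tracks_Arr[OF t(2) am(2)]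
        tracks_Arr[OF t(3) am(3)]] by simp
  also have "\<dots> = ((\<gamma> \<uplus> (\<gamma>' \<uplus> \<gamma>'')) \<box> (\<iota> (a \<cdot> m) \<uplus> L a m' m'')) \<box> L a m (m' \<boxplus> m'')"
    using Vcmp_assoc[OF Tadd_tracks[OF am(1) Add_in_Hom[OF am(2,3)] t(1) A(2)]
        Tadd_tracks[OF am(1) amm(2) Idt_tracks[OF am(1)] LT(2)] LL(2)] by simp
  also have "(\<gamma> \<uplus> (\<gamma>' \<uplus> \<gamma>'')) \<box> (\<iota> (a \<cdot> m) \<uplus> L a m' m'') = \<gamma> \<uplus> ((\<gamma>' \<uplus> \<gamma>'') \<box> L a m' m'')"
    using Tadd_interchange[OF am(1) amm(2) Idt_tracks[OF am(1)] t(1) LT(2) A(2)] Vcmp_Idt[OF t(1)] by simp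
  finally show ?thesis .
qed

text \<open>The map \<open>m\<close> is stored along with the track because
  \<open>a \<cdot> m\<close> need not determine it. Targets are left free. Reading the end objects
  off \<open>a\<close> keeps the parameters down to \<open>X\<close> and \<open>a\<close>.\<close>

definition lift_group :: "'o \<Rightarrow> 'm \<Rightarrow> ('m \<times> 't) monoid" where
  "lift_group X a =
    \<lparr>carrier = {(m, \<gamma>). m \<in> Hom T X (Dom T a) \<and> \<gamma> \<in> Trk T \<and> Src T \<gamma> = a \<cdot> m},
     monoid.mult = (\<lambda>(m, \<gamma>) (m', \<gamma>'). (m \<boxplus> m', (\<gamma> \<uplus> \<gamma>') \<box> L a m m')),
     one = (Zero T X (Dom T a), \<iota> (Zero T X (Cod T a)))\<rparr>"

lemma lift_group_mult [simp]:
  "(m, \<gamma>) \<otimes>\<^bsub>lift_group X a\<^esub> (m', \<gamma>') = (m \<boxplus> m', (\<gamma> \<uplus> \<gamma>') \<box> L a m m')"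
  by (simp add: lift_group_def)

lemma lift_group_carrier:
  "a \<in> Hom T A B \<Longrightarrow> (m, \<gamma>) \<in> carrier (lift_group X a) \<longleftrightarrow>
    m \<in> Hom T X A \<and> \<gamma> \<in> tracks T (a \<cdot> m) (Tgt T \<gamma>)"
  by (auto simp: lift_group_def tracks_def Hom_def)

lemma lift_group_one:
  "a \<in> Hom T A B \<Longrightarrow> \<one>\<^bsub>lift_group X a\<^esub> = (Zero T X A, \<iota> (Zero T X B))"
  by (auto simp: lift_group_def Hom_def)

lemma lift_group_carrierI:
  "a \<in> Hom T A B \<Longrightarrow> m \<in> Hom T X A \<Longrightarrow> \<gamma> \<in> tracks T (a \<cdot> m) n \<Longrightarrow>
    (m, \<gamma>) \<in> carrier (lift_group X a)"
  by (auto simp: lift_group_def tracks_def Hom_def)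

text \<open>Inverses are the delicate point: for \<open>m' = - m\<close> the map
  \<open>a \<cdot> m'\<close> need not be \<open>- (a \<cdot> m)\<close>. So
  \<open>- \<gamma>\<close> may have the wrong source and is corrected by the inverse of the
  linearity track \<open>L a m m'\<close>.\<close>

lemma lift_comm_group:
  assumes a: "a \<in> Hom T A B" and X: "X \<in> Obj T"
  shows "comm_group (lift_group X a)"
proof -
  let ?G = "lift_group X a"
  note car = lift_group_carrier[OF a]
  have Ob: "A \<in> Obj T" "B \<in> Obj T"
    using a Hom_Obj by blast+
  have Z: "Zero T X A \<in> Hom T X A" "Zero T X B \<in> Hom T X B" "a \<cdot> Zero T X A = Zero T X B"
    using Zero_in_Hom X Ob Cmp_Zero[OF a X] by auto
  have comm: "p \<otimes>\<^bsub>?G\<^esub> q = q \<otimes>\<^bsub>?G\<^esub> p" if "p \<in> carrier ?G" "q \<in> carrier ?G" for p q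
  proof -
    obtain m \<gamma> m' \<gamma>' where pq: "p = (m, \<gamma>)" "q = (m', \<gamma>')"
      by fastforce
    then have h: "m \<in> Hom T X A" "m' \<in> Hom T X A"
      "\<gamma> \<in> tracks T (a \<cdot> m) (Tgt T \<gamma>)" "\<gamma>' \<in> tracks T (a \<cdot> m') (Tgt T \<gamma>')"
      using that car by auto
    show ?thesis
      using Add_comm[OF h(1,2)] lin_sym[OF a h(1,2)]
        Tadd_comm[OF tracks_Arr[OF h(3) Cmp_in_Hom[OF a h(1)]] tracks_Arr[OF h(4) Cmp_in_Hom[OF a h(2)]]]
      by (simp add: pq)
  qed
  show ?thesis
  proof (rule comm_groupI)
    show "\<one>\<^bsub>?G\<^esub> \<in> carrier ?G"
      using lift_group_carrierI[OF a Z(1)] Idt_tracks[OF Z(2)] Z(3) lift_group_one[OF a] by simp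
    show "p \<otimes>\<^bsub>?G\<^esub> q = q \<otimes>\<^bsub>?G\<^esub> p" if "p \<in> carrier ?G" "q \<in> carrier ?G" for p q
      using comm that .
  next
    fix p q assume "p \<in> carrier ?G" "q \<in> carrier ?G"
    moreover obtain m \<gamma> m' \<gamma>' where pq: "p = (m, \<gamma>)" "q = (m', \<gamma>')"
      by fastforce
    ultimately have h: "m \<in> Hom T X A" "m' \<in> Hom T X A"
      "\<gamma> \<in> tracks T (a \<cdot> m) (Tgt T \<gamma>)" "\<gamma>' \<in> tracks T (a \<cdot> m') (Tgt T \<gamma>')"
      using car by auto
    show "p \<otimes>\<^bsub>?G\<^esub> q \<in> carrier ?G"
      using lift_group_carrierI[OF a Add_in_Hom[OF h(1,2)] lin_sum_tracks[OF a h]] pq by simp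
  next
    fix p q r assume "p \<in> carrier ?G" "q \<in> carrier ?G" "r \<in> carrier ?G"
    moreover obtain m \<gamma> m' \<gamma>' m'' \<gamma>'' where pq: "p = (m, \<gamma>)" "q = (m', \<gamma>')" "r = (m'', \<gamma>'')"
      by (metis surj_pair)
    ultimately have h: "m \<in> Hom T X A" "m' \<in> Hom T X A" "m'' \<in> Hom T X A"
      "\<gamma> \<in> tracks T (a \<cdot> m) (Tgt T \<gamma>)" "\<gamma>' \<in> tracks T (a \<cdot> m') (Tgt T \<gamma>')"
      "\<gamma>'' \<in> tracks T (a \<cdot> m'') (Tgt T \<gamma>'')"
      using car by auto
    show "p \<otimes>\<^bsub>?G\<^esub> q \<otimes>\<^bsub>?G\<^esub> r = p \<otimes>\<^bsub>?G\<^esub> (q \<otimes>\<^bsub>?G\<^esub> r)"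
      using lin_sum_assoc[OF a h] Add_assoc[OF h(1-3)] pq by simp
  next
    fix p assume "p \<in> carrier ?G"
    moreover obtain m \<gamma> where p: "p = (m, \<gamma>)"
      by fastforce
    ultimately have h: "m \<in> Hom T X A" "\<gamma> \<in> tracks T (a \<cdot> m) (Tgt T \<gamma>)"
      using car by auto
    note am = Cmp_in_Hom[OF a h(1)]
    show "\<one>\<^bsub>?G\<^esub> \<otimes>\<^bsub>?G\<^esub> p = p"
      using Zero_Add[OF h(1)] lin_Zero[OF a h(1)] Zero_Tadd[OF tracks_Arr[OF h(2) am]] Vcmp_Idt[OF h(2)]
      by (simp add: p lift_group_one[OF a])
  next
    fix p assume pG: "p \<in> carrier ?G"
    moreover obtain m \<gamma> where p: "p = (m, \<gamma>)"
      by fastforce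
    ultimately have h: "m \<in> Hom T X A" "\<gamma> \<in> tracks T (a \<cdot> m) (Tgt T \<gamma>)"
      using car by auto
    obtain m' where m': "m' \<in> Hom T X A" "m \<boxplus> m' = Zero T X A"
      using Add_inverse[OF h(1)] by blast
    note am = Cmp_in_Hom[OF a h(1)] Cmp_in_Hom[OF a m'(1)]
    have "L a m m' \<in> tracks T (Zero T X B) (a \<cdot> m \<boxplus> a \<cdot> m')"
      using lin_track[OF a h(1) m'(1)] m'(2) Z(3) by simp
    then obtain \<beta> where b: "\<beta> \<in> tracks T (a \<cdot> m \<boxplus> a \<cdot> m') (Zero T X B)"
      "\<beta> \<box> L a m m' = \<iota> (Zero T X B)"
      using track_inverse by metis
    note bA = tracks_Arr[OF b(1) Add_in_Hom[OF am]] and gA = tracks_Arr[OF h(2) am(1)]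
    obtain \<gamma>' where g': "\<gamma>' \<in> Arr (hom_gpd T X B)" "\<gamma> \<uplus> \<gamma>' = \<iota> (Zero T X B)"
      using Tadd_inverse[OF gA] by blast
    \<comment> \<open>The equation to be solved is
      \<open>(\<gamma> \<uplus> \<delta>) \<box> L a m m' = \<iota> 0\<close>. It forces
      \<open>\<gamma> \<uplus> \<delta>\<close> to be the inverse \<open>\<beta>\<close> of the
      linearity track, hence \<open>\<delta>\<close> to be \<open>\<beta>\<close> minus
      \<open>\<gamma>\<close>.\<close>
    define \<delta> where "\<delta> = \<gamma>' \<uplus> \<beta>"
    have d: "\<delta> \<in> Arr (hom_gpd T X B)" "\<gamma> \<uplus> \<delta> = \<beta>"
      using Tadd_Arr[OF g'(1) bA] Tadd_assoc[OF gA g'(1) bA] Zero_Tadd[OF bA] g'(2)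
      by (simp_all add: \<delta>_def)
    have sd: "Src T \<delta> \<in> Hom T X B"
      using d(1) by (simp add: Arr_hom_gpd_iff)
    \<comment> \<open>Sources are additive, so comparing them in
      \<open>\<gamma> \<uplus> \<delta> = \<beta>\<close> shows that \<open>\<delta>\<close> starts
      at \<open>a \<cdot> m'\<close>, as membership in the group demands.\<close>
    have "a \<cdot> m \<boxplus> Src T \<delta> = a \<cdot> m \<boxplus> a \<cdot> m'"
      using Tadd_tracks[OF am(1) sd h(2) Arr_tracks[OF d(1)]] b(1) d(2) by (simp add: tracks_def)
    then have "Src T \<delta> = a \<cdot> m'"
      using Add_right_cancel[OF am(1) sd am(2)] Add_comm[OF am(1)] sd am(2) by simp
    then have q: "(m', \<delta>) \<in> carrier ?G"
      using lift_group_carrierI[OF a m'(1)] Arr_tracks[OF d(1)] by simp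
    have "p \<otimes>\<^bsub>?G\<^esub> (m', \<delta>) = \<one>\<^bsub>?G\<^esub>"
      by (simp add: p m'(2) d(2) b(2) lift_group_one[OF a])
    then show "\<exists>q\<in>carrier ?G. q \<otimes>\<^bsub>?G\<^esub> p = \<one>\<^bsub>?G\<^esub>"
      using q comm[OF pG q] by metis
  qed
qed

text \<open>Equivalently, \<open>y \<mapsto> (m y, f y)\<close> is a homomorphism into \<open>lift_group X a\<close>.\<close>

definition lin_additive ::
  "('p, 'a, 'y) cat_scheme \<Rightarrow> 'p \<Rightarrow> 'p \<Rightarrow> 'o \<Rightarrow> 'm \<Rightarrow> (('p, 'a \<Rightarrow>\<^sub>0 int) mor \<Rightarrow> 'm) \<Rightarrow>
    (('p, 'a \<Rightarrow>\<^sub>0 int) mor \<Rightarrow> 't) \<Rightarrow> bool"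
  where
  "lin_additive C P Q X a m f \<longleftrightarrow>
    (\<forall>y\<in>Hom (int_cat C) P Q.
      m y \<in> Hom T X (Dom T a) \<and> f y \<in> Trk T \<and> Src T (f y) = a \<cdot> m y) \<and>
    (\<forall>y\<in>Hom (int_cat C) P Q. \<forall>z\<in>Hom (int_cat C) P Q.
      m (lin_add y z) = m y \<boxplus> m z \<and> f (lin_add y z) = (f y \<uplus> f z) \<box> L a (m y) (m z))"

section \<open>Homomorphisms into the lift groups: uniqueness and constructions\<close>

lemma lin_additiveI:
  assumes "a \<in> Hom T A B"
    "\<And>y. y \<in> Hom (int_cat C) P Q \<Longrightarrow> m y \<in> Hom T X A"
    "\<And>y. y \<in> Hom (int_cat C) P Q \<Longrightarrow> f y \<in> tracks T (a \<cdot> m y) (n y)"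
    "\<And>y z. y \<in> Hom (int_cat C) P Q \<Longrightarrow> z \<in> Hom (int_cat C) P Q \<Longrightarrow>
      m (lin_add y z) = m y \<boxplus> m z"
    "\<And>y z. y \<in> Hom (int_cat C) P Q \<Longrightarrow> z \<in> Hom (int_cat C) P Q \<Longrightarrow>
      f (lin_add y z) = (f y \<uplus> f z) \<box> L a (m y) (m z)"
  shows "lin_additive C P Q X a m f"
  using assms unfolding lin_additive_def by (auto simp: Hom_def[of T] tracks_def)

lemma lin_additive_cong:
  assumes "lin_additive C P Q X a m f" "\<And>y. y \<in> Hom (int_cat C) P Q \<Longrightarrow> m y = m' y"
  shows "lin_additive C P Q X a m' f"
  using assms(1) unfolding lin_additive_def by (simp add: lin_add_in_Hom assms(2)[symmetric])

text \<open>Homomorphisms on a free abelian group that agree on the basis are equal. The first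
  component \<open>m\<close> is shared, so only the tracks are at stake; their targets are not
  assumed to agree.\<close>

lemma lin_additive_unique:
  assumes a: "a \<in> Hom T A B" and X: "X \<in> Obj T"
    and f: "lin_additive C P Q X a m f" and g: "lin_additive C P Q X a m g"
    and of: "\<And>w. w \<in> Hom C P Q \<Longrightarrow> f (lin_of C w) = g (lin_of C w)"
    and y: "y \<in> Hom (int_cat C) P Q"
  shows "f y = g y"
  using y
proof (induction y rule: linear_cat_induct)
  case zero
  have z: "Mor P Q (0 :: 'b \<Rightarrow>\<^sub>0 int) \<in> Hom (int_cat C) P Q"
    using y by (simp add: Hom_linear_cat_iff)
  \<comment> \<open>From \<open>0 + 0 = 0\<close> follows \<open>m 0 = 0\<close>, so that the
    linearity track in the sum is an identity and \<open>f' 0\<close> is idempotent for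
    \<open>\<uplus>\<close>.\<close>
  have vanish: "f' (Mor P Q 0) = \<iota> (Zero T X B)" if f': "lin_additive C P Q X a m f'" for f'
  proof -
    let ?z = "Mor P Q (0 :: 'b \<Rightarrow>\<^sub>0 int)"
    have D: "Dom T a = A" using a by (simp add: Hom_def)
    have m: "m ?z \<in> Hom T X A" and t: "f' ?z \<in> tracks T (a \<cdot> m ?z) (Tgt T (f' ?z))"
      and "m (lin_add ?z ?z) = m ?z \<boxplus> m ?z"
      and s: "f' (lin_add ?z ?z) = (f' ?z \<uplus> f' ?z) \<box> L a (m ?z) (m ?z)"
      using f' z unfolding lin_additive_def D by (auto simp: tracks_def)
    moreover have zz: "lin_add ?z ?z = ?z" by (simp add: lin_add_def)
    moreover have Z: "Zero T X A \<in> Hom T X A"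
      using Zero_in_Hom X Hom_Obj[OF a] by blast
    ultimately have m0: "m ?z = Zero T X A"
      using Add_right_cancel[OF m m Z] Zero_Add[OF m] by simp
    have am: "a \<cdot> m ?z \<in> Hom T X B"
      using Cmp_in_Hom[OF a m] .
    have tA: "f' ?z \<in> Arr (hom_gpd T X B)"
      using tracks_Arr[OF t am] .
    have "a \<cdot> m ?z \<boxplus> a \<cdot> m ?z = a \<cdot> m ?z"
      using Cmp_Zero[OF a X] Zero_Add[OF am] m0 by simp
    then have "f' ?z = f' ?z \<uplus> f' ?z"
      using s zz lin_Zero[OF a m] Vcmp_Idt[OF Tadd_tracks[OF am am t t]] m0 by simp
    then show ?thesis
      using Tadd_right_cancel[OF tA tA Idt_Arr[OF Zero_in_Hom]] Zero_Tadd[OF tA] X Hom_Obj[OF a] by metis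
  qed
  show ?case using vanish[OF f] vanish[OF g] by simp
next
  case (lin_of w)
  then show ?case using of by simp
next
  case (cancel y z)
  have D: "Dom T a = A" using a by (simp add: Hom_def)
  have m: "m y \<in> Hom T X A" "m z \<in> Hom T X A"
    and t: "f y \<in> tracks T (a \<cdot> m y) (Tgt T (f y))" "g y \<in> tracks T (a \<cdot> m y) (Tgt T (g y))"
      "f z \<in> tracks T (a \<cdot> m z) (Tgt T (f z))" "g z \<in> tracks T (a \<cdot> m z) (Tgt T (g z))"
    and s: "f (lin_add y z) = (f y \<uplus> f z) \<box> L a (m y) (m z)"
      "g (lin_add y z) = (g y \<uplus> g z) \<box> L a (m y) (m z)"
    using f g cancel(1,2) unfolding lin_additive_def D by (auto simp: tracks_def)
  note am = Cmp_in_Hom[OF a m(1)] Cmp_in_Hom[OF a m(2)]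
  have "(f y \<uplus> f z) \<box> L a (m y) (m z) = (g y \<uplus> g z) \<box> L a (m y) (m z)"
    using cancel(3) s by simp
  \<comment> \<open>The common linearity track cancels in the groupoid. As \<open>f z = g z\<close>,
    the second summand can then be cancelled in the group of tracks.\<close>
  then have "f y \<uplus> f z = g y \<uplus> f z"
    using Vcmp_right_cancel[OF Tadd_tracks[OF am t(1,3)] Tadd_tracks[OF am t(2,4)] lin_track[OF a m]]
      cancel(4) by simp
  then show ?case
    using Tadd_right_cancel tracks_Arr[OF t(1) am(1)] tracks_Arr[OF t(2) am(1)] tracks_Arr[OF t(3) am(2)]
    by blast
qed

lemma lin_additiveD:
  assumes "lin_additive C P Q X a m f" "a \<in> Hom T A B" "y \<in> Hom (int_cat C) P Q"
  shows "m y \<in> Hom T X A" "f y \<in> tracks T (a \<cdot> m y) (Tgt T (f y))" "a \<cdot> m y \<in> Hom T X B"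
    "f y \<in> Arr (hom_gpd T X B)"
    "z \<in> Hom (int_cat C) P Q \<Longrightarrow> m (lin_add y z) = m y \<boxplus> m z"
    "z \<in> Hom (int_cat C) P Q \<Longrightarrow> f (lin_add y z) = (f y \<uplus> f z) \<box> L a (m y) (m z)"
proof -
  have D: "Dom T a = A" using assms(2) by (simp add: Hom_def)
  show m: "m y \<in> Hom T X A" and t: "f y \<in> tracks T (a \<cdot> m y) (Tgt T (f y))"
    "z \<in> Hom (int_cat C) P Q \<Longrightarrow> m (lin_add y z) = m y \<boxplus> m z"
    "z \<in> Hom (int_cat C) P Q \<Longrightarrow> f (lin_add y z) = (f y \<uplus> f z) \<box> L a (m y) (m z)"
    using assms(1,3) unfolding lin_additive_def D by (auto simp: tracks_def)
  show am: "a \<cdot> m y \<in> Hom T X B"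
    using Cmp_in_Hom[OF assms(2) m] .
  show "f y \<in> Arr (hom_gpd T X B)"
    using tracks_Arr[OF t(1) am] .
qed

text \<open>By left linearity and \<open>lin_add\<close>, homomorphisms over \<open>a\<close> and
  \<open>a'\<close> with the same first component can be added. This is the source of additivity of
  \<open>\<Gamma>\<close> in its left argument.\<close>

lemma lin_additive_add:
  assumes a: "a \<in> Hom T A B" and a': "a' \<in> Hom T A B"
    and f: "lin_additive C P Q X a m f" and f': "lin_additive C P Q X a' m f'"
  shows "lin_additive C P Q X (a \<boxplus> a') m (\<lambda>y. f y \<uplus> f' y)"
proof (rule lin_additiveI[OF Add_in_Hom[OF a a']])
  fix y assume y: "y \<in> Hom (int_cat C) P Q"
  note fy = lin_additiveD[OF f a y] and fy' = lin_additiveD[OF f' a' y]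
  show "m y \<in> Hom T X A" by fact
  show "f y \<uplus> f' y \<in> tracks T ((a \<boxplus> a') \<cdot> m y) (Tgt T (f y) \<boxplus> Tgt T (f' y))"
    using Tadd_tracks[OF fy(3) fy'(3) fy(2) fy'(2)] Cmp_left_linear[OF a a' fy(1)] by simp
  fix z assume z: "z \<in> Hom (int_cat C) P Q"
  note fz = lin_additiveD[OF f a z] and fz' = lin_additiveD[OF f' a' z]
  show "m (lin_add y z) = m y \<boxplus> m z"
    using fy(5) z .
  have "f (lin_add y z) \<uplus> f' (lin_add y z) =
      ((f y \<uplus> f z) \<box> L a (m y) (m z)) \<uplus> ((f' y \<uplus> f' z) \<box> L a' (m y) (m z))"
    using fy(6)[OF z] fy'(6)[OF z] by simp
  also have "\<dots> = ((f y \<uplus> f z) \<uplus> (f' y \<uplus> f' z)) \<box> (L a (m y) (m z) \<uplus> L a' (m y) (m z))"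
    using Tadd_interchange[OF _ _ lin_track[OF a fy(1) fz(1)] Tadd_tracks[OF fy(3) fz(3) fy(2) fz(2)]
        lin_track[OF a' fy(1) fz(1)] Tadd_tracks[OF fy'(3) fz'(3) fy'(2) fz'(2)]]
      Cmp_in_Hom[OF a Add_in_Hom[OF fy(1) fz(1)]] Cmp_in_Hom[OF a' Add_in_Hom[OF fy(1) fz(1)]] .
  also have "\<dots> = (f y \<uplus> f' y \<uplus> (f z \<uplus> f' z)) \<box> L (a \<boxplus> a') (m y) (m z)"
    using lin_add[OF a a' fy(1) fz(1)] Tadd_middle_swap[OF fy(4) fz(4) fy'(4) fz'(4)] by simp
  finally show "f (lin_add y z) \<uplus> f' (lin_add y z) =
      (f y \<uplus> f' y \<uplus> (f z \<uplus> f' z)) \<box> L (a \<boxplus> a') (m y) (m z)" .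
qed

text \<open>Precomposition is strictly additive and \<open>lin_precomp\<close> carries the linearity
  track along, so whiskering with \<open>x\<close> is a homomorphism of lift groups. It serves right
  multiplication by words.\<close>

lemma lin_additive_precomp:
  assumes a: "a \<in> Hom T A B" and f: "lin_additive C P Q X a m f" and x: "x \<in> Hom T Y X"
  shows "lin_additive C P Q Y a (\<lambda>y. m y \<cdot> x) (\<lambda>y. f y \<star> \<iota> x)"
proof (rule lin_additiveI[OF a])
  fix y assume y: "y \<in> Hom (int_cat C) P Q"
  note fy = lin_additiveD[OF f a y]
  show "m y \<cdot> x \<in> Hom T Y A" using Cmp_in_Hom[OF fy(1) x] .
  show "f y \<star> \<iota> x \<in> tracks T (a \<cdot> (m y \<cdot> x)) (Tgt T (f y) \<cdot> x)"
    using Hcmp_tracks[OF fy(3) x fy(2) Idt_tracks[OF x]] Cmp_assoc[OF a fy(1) x] by simp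
  fix z assume z: "z \<in> Hom (int_cat C) P Q"
  note fz = lin_additiveD[OF f a z]
  show "m (lin_add y z) \<cdot> x = m y \<cdot> x \<boxplus> m z \<cdot> x"
    using fy(5)[OF z] Cmp_left_linear[OF fy(1) fz(1) x] by simp
  have "f (lin_add y z) \<star> \<iota> x = (f y \<uplus> f z) \<star> \<iota> x \<box> L a (m y) (m z) \<star> \<iota> x"
    using Hcmp_whisker_right[OF Cmp_in_Hom[OF a Add_in_Hom[OF fy(1) fz(1)]] x
        lin_track[OF a fy(1) fz(1)] Tadd_tracks[OF fy(3) fz(3) fy(2) fz(2)]] fy(6)[OF z] by simp
  also have "\<dots> = (f y \<star> \<iota> x \<uplus> f z \<star> \<iota> x) \<box> L a (m y \<cdot> x) (m z \<cdot> x)"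
    using Hcmp_left_linear[OF fy(4) fz(4) Idt_Arr[OF x]] lin_precomp[OF a fy(1) fz(1) x] by simp
  finally show "f (lin_add y z) \<star> \<iota> x = (f y \<star> \<iota> x \<uplus> f z \<star> \<iota> x) \<box> L a (m y \<cdot> x) (m z \<cdot> x)" .
qed

text \<open>The track \<open>\<alpha>\<close> pulls tracks out of \<open>a' \<cdot> m\<close> back
  to tracks out of \<open>a \<cdot> m\<close>; by \<open>lin_natural_left\<close> this is a
  homomorphism from the group of \<open>a'\<close> to that of \<open>a\<close>.\<close>

lemma lin_additive_track:
  assumes a: "a \<in> Hom T A B" and \<alpha>: "\<alpha> \<in> tracks T a a'" and f: "lin_additive C P Q X a' m f"
  shows "lin_additive C P Q X a m (\<lambda>y. f y \<box> \<alpha> \<star> \<iota> (m y))"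
proof (rule lin_additiveI[OF a])
  have a': "a' \<in> Hom T A B" using tracks_Tgt[OF \<alpha> a] .
  fix y assume y: "y \<in> Hom (int_cat C) P Q"
  note fy = lin_additiveD[OF f a' y]
  note \<alpha>y = Hcmp_tracks[OF a fy(1) \<alpha> Idt_tracks[OF fy(1)]]
  show "m y \<in> Hom T X A" by fact
  show "f y \<box> \<alpha> \<star> \<iota> (m y) \<in> tracks T (a \<cdot> m y) (Tgt T (f y))"
    using Vcmp_tracks[OF fy(2) \<alpha>y] .
  fix z assume z: "z \<in> Hom (int_cat C) P Q"
  note fz = lin_additiveD[OF f a' z]
  note \<alpha>z = Hcmp_tracks[OF a fz(1) \<alpha> Idt_tracks[OF fz(1)]]
  show "m (lin_add y z) = m y \<boxplus> m z"
    using fy(5) z .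
  note yz = Add_in_Hom[OF fy(1) fz(1)]
  note ay = Cmp_in_Hom[OF a fy(1)] and az = Cmp_in_Hom[OF a fz(1)]
  note Ff = Tadd_tracks[OF fy(3) fz(3) fy(2) fz(2)] and Fa = Tadd_tracks[OF ay az \<alpha>y \<alpha>z]
  have "f (lin_add y z) \<box> \<alpha> \<star> \<iota> (m (lin_add y z)) =
      (f y \<uplus> f z) \<box> (L a' (m y) (m z) \<box> \<alpha> \<star> \<iota> (m y \<boxplus> m z))"
    using fy(5,6)[OF z] Vcmp_assoc[OF Ff lin_track[OF a' fy(1) fz(1)] Hcmp_tracks[OF a yz \<alpha> Idt_tracks[OF yz]]]
    by simp
  also have "\<dots> = (f y \<uplus> f z) \<box> ((\<alpha> \<star> \<iota> (m y) \<uplus> \<alpha> \<star> \<iota> (m z)) \<box> L a (m y) (m z))"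
    using lin_natural_left[OF a a' fy(1) fz(1) \<alpha>] by simp
  also have "\<dots> = (f y \<uplus> f z) \<box> (\<alpha> \<star> \<iota> (m y) \<uplus> \<alpha> \<star> \<iota> (m z)) \<box> L a (m y) (m z)"
    using Vcmp_assoc[OF Ff Fa lin_track[OF a fy(1) fz(1)]] by simp
  also have "(f y \<uplus> f z) \<box> (\<alpha> \<star> \<iota> (m y) \<uplus> \<alpha> \<star> \<iota> (m z)) =
      (f y \<box> \<alpha> \<star> \<iota> (m y)) \<uplus> (f z \<box> \<alpha> \<star> \<iota> (m z))"
    using Tadd_interchange[OF ay az \<alpha>y fy(2) \<alpha>z fz(2)] by simp
  finally show "f (lin_add y z) \<box> \<alpha> \<star> \<iota> (m (lin_add y z)) =
      (f y \<box> \<alpha> \<star> \<iota> (m y)) \<uplus> (f z \<box> \<alpha> \<star> \<iota> (m z)) \<box> L a (m y) (m z)" .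
qed

text \<open>That the first component for \<open>f\<close> is the target of \<open>g\<close> makes
  the two tracks pasteable. \<open>lin_comp\<close> splits the linearity track of
  \<open>b \<cdot> a\<close>, and \<open>lin_natural\<close> slides the part belonging to
  \<open>b\<close> along \<open>g\<close>.\<close>

lemma lin_additive_comp:
  assumes b: "b \<in> Hom T B D" and a: "a \<in> Hom T A B"
    and f: "lin_additive C P Q X b (\<lambda>y. Tgt T (g y)) f" and g: "lin_additive C P Q X a m g"
  shows "lin_additive C P Q X (b \<cdot> a) m (\<lambda>y. f y \<box> \<iota> b \<star> g y)"
proof (rule lin_additiveI[OF Cmp_in_Hom[OF b a]])
  fix y assume y: "y \<in> Hom (int_cat C) P Q"
  note fy = lin_additiveD[OF f b y] and gy = lin_additiveD[OF g a y]
  note bgy = Hcmp_tracks[OF b gy(3) Idt_tracks[OF b] gy(2)]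
  show "m y \<in> Hom T X A" by fact
  show "f y \<box> \<iota> b \<star> g y \<in> tracks T (b \<cdot> a \<cdot> m y) (Tgt T (f y))"
    using Vcmp_tracks[OF fy(2) bgy] Cmp_assoc[OF b a gy(1)] by simp
  fix z assume z: "z \<in> Hom (int_cat C) P Q"
  note fz = lin_additiveD[OF f b z] and gz = lin_additiveD[OF g a z]
  note bgz = Hcmp_tracks[OF b gz(3) Idt_tracks[OF b] gz(2)]
  show "m (lin_add y z) = m y \<boxplus> m z"
    using gy(5) z .
  note yz = Add_in_Hom[OF gy(1) gz(1)] and nyz = Add_in_Hom[OF fy(1) fz(1)]
  note ayz = Cmp_in_Hom[OF a yz] and aayz = Add_in_Hom[OF gy(3) gz(3)]
  note Ff = Tadd_tracks[OF fy(3) fz(3) fy(2) fz(2)] and Fg = Tadd_tracks[OF gy(3) gz(3) gy(2) gz(2)]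
  note La = lin_track[OF a gy(1) gz(1)]
  note Lb = lin_track[OF b fy(1) fz(1)] and Lb' = lin_track[OF b gy(3) gz(3)]
  note bLa = Hcmp_tracks[OF b ayz Idt_tracks[OF b] La]
  note bFg = Hcmp_tracks[OF b aayz Idt_tracks[OF b] Fg]
  note bay = Cmp_in_Hom[OF b gy(3)] and baz = Cmp_in_Hom[OF b gz(3)]
  note Fbg = Tadd_tracks[OF bay baz bgy bgz]
  let ?Lb = "L b (Tgt T (g y)) (Tgt T (g z))" and ?La = "L a (m y) (m z)"
  have "f (lin_add y z) \<box> \<iota> b \<star> g (lin_add y z) =
      ((f y \<uplus> f z) \<box> ?Lb) \<box> (\<iota> b \<star> (g y \<uplus> g z) \<box> \<iota> b \<star> ?La)"
    using fy(6)[OF z] gy(6)[OF z] Hcmp_whisker_left[OF b ayz La Fg] by simp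
  also have "\<dots> = (f y \<uplus> f z) \<box> (?Lb \<box> (\<iota> b \<star> (g y \<uplus> g z) \<box> \<iota> b \<star> ?La))"
    using Vcmp_assoc[OF Ff Lb Vcmp_tracks[OF bFg bLa]] .
  also have "?Lb \<box> (\<iota> b \<star> (g y \<uplus> g z) \<box> \<iota> b \<star> ?La) = (?Lb \<box> \<iota> b \<star> (g y \<uplus> g z)) \<box> \<iota> b \<star> ?La"
    using Vcmp_assoc[OF Lb bFg bLa] by simp
  \<comment> \<open>Naturality trades the linearity track at the targets of \<open>g y\<close> and
    \<open>g z\<close> for the one at their sources, which is the one occurring in
    \<open>lin_comp\<close>.\<close>
  also have "?Lb \<box> \<iota> b \<star> (g y \<uplus> g z) =
      (\<iota> b \<star> g y \<uplus> \<iota> b \<star> g z) \<box> L b (a \<cdot> m y) (a \<cdot> m z)"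
    using lin_natural[OF b gy(3) fy(1) gz(3) fz(1) gy(2) gz(2)] by simp
  also have "\<dots> \<box> \<iota> b \<star> ?La = (\<iota> b \<star> g y \<uplus> \<iota> b \<star> g z) \<box> L (b \<cdot> a) (m y) (m z)"
    using Vcmp_assoc[OF Fbg Lb' bLa] lin_comp[OF b a gy(1) gz(1)] by simp
  also have "(f y \<uplus> f z) \<box> ((\<iota> b \<star> g y \<uplus> \<iota> b \<star> g z) \<box> L (b \<cdot> a) (m y) (m z)) =
      ((f y \<uplus> f z) \<box> (\<iota> b \<star> g y \<uplus> \<iota> b \<star> g z)) \<box> L (b \<cdot> a) (m y) (m z)"
    using Vcmp_assoc[OF Ff Fbg, of "L (b \<cdot> a) (m y) (m z)"]
      lin_track[OF Cmp_in_Hom[OF b a] gy(1) gz(1)] Cmp_assoc[OF b a gy(1)] Cmp_assoc[OF b a gz(1)]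
    by simp
  also have "(f y \<uplus> f z) \<box> (\<iota> b \<star> g y \<uplus> \<iota> b \<star> g z) =
      (f y \<box> \<iota> b \<star> g y) \<uplus> (f z \<box> \<iota> b \<star> g z)"
    using Tadd_interchange[OF bay baz bgy fy(2) bgz fz(2)] by simp
  finally show "f (lin_add y z) \<box> \<iota> b \<star> g (lin_add y z) =
      (f y \<box> \<iota> b \<star> g y) \<uplus> (f z \<box> \<iota> b \<star> g z) \<box> L (b \<cdot> a) (m y) (m z)" .
qed

lemma lin_additive_reindex:
  assumes a: "a \<in> Hom T A B" and f: "lin_additive C P Q X a m f"
    and u: "\<And>y. y \<in> Hom (int_cat C') P' Q' \<Longrightarrow> u y \<in> Hom (int_cat C) P Q"
    and u_add: "\<And>y z. y \<in> Hom (int_cat C') P' Q' \<Longrightarrow> z \<in> Hom (int_cat C') P' Q' \<Longrightarrow>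
      u (lin_add y z) = lin_add (u y) (u z)"
  shows "lin_additive C' P' Q' X a (\<lambda>y. m (u y)) (\<lambda>y. f (u y))"
  using lin_additiveD[OF f a u]
  by (intro lin_additiveI[OF a, where n = "\<lambda>y. Tgt T (f (u y))"]) (auto simp: u u_add)

text \<open>Over an identity map the twist disappears by \<open>lin_Ide\<close>. The resulting
  family is the comparison object for the left unit law.\<close>

lemma lin_additive_Idt:
  assumes "A \<in> Obj T" and m: "\<And>y. y \<in> Hom (int_cat C) P Q \<Longrightarrow> m y \<in> Hom T X A"
    and m_add: "\<And>y z. y \<in> Hom (int_cat C) P Q \<Longrightarrow> z \<in> Hom (int_cat C) P Q \<Longrightarrow>
      m (lin_add y z) = m y \<boxplus> m z"
  shows "lin_additive C P Q X (Ide T A) m (\<lambda>y. \<iota> (m y))"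
proof (rule lin_additiveI[OF Ide_in_Hom[OF assms(1)] m])
  fix y z assume y: "y \<in> Hom (int_cat C) P Q"
  then show "\<iota> (m y) \<in> tracks T (Ide T A \<cdot> m y) (m y)"
    using Idt_tracks[OF m] Ide_Cmp[OF m] by simp
  assume z: "z \<in> Hom (int_cat C) P Q"
  show "m (lin_add y z) = m y \<boxplus> m z"
    using m_add y z .
  then show "\<iota> (m (lin_add y z)) = (\<iota> (m y) \<uplus> \<iota> (m z)) \<box> L (Ide T A) (m y) (m z)"
    using Vcmp_Idt[OF Idt_tracks[OF Add_in_Hom[OF m[OF y] m[OF z]]]] Tadd_Idt[OF m[OF y] m[OF z]]
      lin_Ide[OF m[OF y] m[OF z]] by simp
qed

end

section \<open>The pseudo-functor\<close>

locale lifted_graph = linearity_tracks F L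
  for F :: "('o, 'm, 't) lin_track_cat" (structure) and L :: "'m \<Rightarrow> 'm \<Rightarrow> 'm \<Rightarrow> 't" +
  fixes E :: "('o, 'e) pre_digraph" and sV :: "'o \<Rightarrow> 'o" and sE :: "'e \<Rightarrow> 'm"
  assumes wf: "wf_digraph E" and lift: "graph_morphism E (under_graph F) sV sE"
begin

abbreviation h :: "('o, 'e list) mor \<Rightarrow> 'm" where
  "h \<equiv> free_extension E F sV sE"

abbreviation s :: "('o, ('o, 'e list) mor \<Rightarrow>\<^sub>0 int) mor \<Rightarrow> 'm" where
  "s \<equiv> linear_extension (map_group F) sV h"

abbreviation B\<^sub>0 :: "('o, ('o, ('o, 'e list) mor \<Rightarrow>\<^sub>0 int) mor) cat" where
  "B\<^sub>0 \<equiv> int_cat (free_cat E)"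

text \<open>The basis values are identities of \<open>s x \<cdot> h w\<close>; that this map is
  \<open>s (x w)\<close> is the separate fact \<open>s_Cmp_lin_of\<close>. The discarded first
  component turns out to be \<open>s y\<close>.\<close>

definition \<gamma> :: "('o, ('o, 'e list) mor \<Rightarrow>\<^sub>0 int) mor \<Rightarrow> ('o, ('o, 'e list) mor \<Rightarrow>\<^sub>0 int) mor \<Rightarrow> 't" where
  "\<gamma> x y = snd (frag_prod (lift_group (sV (mdom y)) (s x)) (\<lambda>w. (h w, \<iota> (s x \<cdot> h w))) (rep y))"

sublocale M: category "free_cat E"
  using wf_digraph.category_free_cat[OF wf] .

sublocale B: category B\<^sub>0
  using M.category_linear_cat .

section \<open>Values of \<open>s\<close> on sums, words and composites\<close>

lemma sV_in_Obj: "A \<in> verts E \<Longrightarrow> sV A \<in> Obj F"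
  using lift by (auto simp: graph_morphism_def under_graph_def)

lemma h_in_Hom: "w \<in> Hom (free_cat E) A B \<Longrightarrow> h w \<in> Hom F (sV A) (sV B)"
  using walk_eval_in_Hom[OF wf lift] by (auto simp: Hom_free_cat_iff free_extension_def)

lemma h_Cmp:
  "v \<in> Hom (free_cat E) B D \<Longrightarrow> w \<in> Hom (free_cat E) A B \<Longrightarrow> h (v \<cdot>\<^bsub>free_cat E\<^esub> w) = h v \<cdot> h w"
  using walk_eval_append[OF wf lift] by (auto simp: Hom_free_cat_iff free_extension_def)

lemma h_Ide: "h (Ide (free_cat E) A) = Ide F (sV A)"
  by (simp add: free_extension_def)

lemma Hom_B_verts:
  assumes "x \<in> Hom B\<^sub>0 A B"
  shows "A \<in> verts E" "B \<in> verts E" "sV A \<in> Obj F" "sV B \<in> Obj F"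
  using assms sV_in_Obj by (auto simp: Hom_linear_cat_iff)

lemma s_in_Hom:
  assumes "x \<in> Hom B\<^sub>0 A B"
  shows "s x \<in> Hom F (sV A) (sV B)"
proof -
  interpret comm_group "map_group F (sV A) (sV B)"
    using map_comm_group Hom_B_verts[OF assms] by blast
  show ?thesis
    using frag_prod_closed[of h "Hom (free_cat E) A B" "rep x"] h_in_Hom assms
    by (auto simp: Hom_linear_cat_iff linear_extension_eq_frag_prod)
qed

lemma s_lin_add:
  assumes "x \<in> Hom B\<^sub>0 A B" "y \<in> Hom B\<^sub>0 A B"
  shows "s (lin_add x y) = s x \<boxplus> s y"
proof -
  interpret comm_group "map_group F (sV A) (sV B)"
    using map_comm_group Hom_B_verts[OF assms(1)] by blast
  show ?thesis
    using frag_prod_add[of h "Hom (free_cat E) A B" "rep x" "rep y"] h_in_Hom assms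
    by (auto simp: Hom_linear_cat_iff linear_extension_eq_frag_prod)
qed

lemma s_zero:
  assumes "A \<in> verts E" "B \<in> verts E"
  shows "s (Mor A B 0) = Zero F (sV A) (sV B)"
proof -
  interpret comm_group "map_group F (sV A) (sV B)"
    using map_comm_group sV_in_Obj assms by blast
  show ?thesis
    by (simp add: linear_extension_eq_frag_prod)
qed

lemma s_lin_of:
  assumes "w \<in> Hom (free_cat E) A B"
  shows "s (lin_of (free_cat E) w) = h w"
proof -
  interpret comm_group "map_group F (sV A) (sV B)"
    using map_comm_group Hom_B_verts[OF M.lin_of_in_Hom[OF assms]] by blast
  have "Dom (free_cat E) w = A" "Cod (free_cat E) w = B"
    using assms by (auto simp: Hom_def)
  then show ?thesis
    using frag_prod_of[of h w] h_in_Hom[OF assms] by (simp add: linear_extension_eq_frag_prod lin_of_def)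
qed

lemma s_Ide: "A \<in> verts E \<Longrightarrow> s (Ide B\<^sub>0 A) = Ide F (sV A)"
  using M.Ide_linear_cat[of A] s_lin_of[OF M.Ide_in_Hom[of A]] h_Ide by simp

text \<open>Both sides are additive in \<open>x\<close>, the right one by left linearity of
  composition; on basis morphisms the claim is functoriality of \<open>h\<close>. This is what gives
  the identity tracks prescribed on words the correct endpoints.\<close>

lemma s_Cmp_lin_of:
  assumes x: "x \<in> Hom B\<^sub>0 B D" and w: "w \<in> Hom (free_cat E) A B"
  shows "s (x \<cdot>\<^bsub>B\<^sub>0\<^esub> lin_of (free_cat E) w) = s x \<cdot> h w"
  using x
proof (induction x rule: linear_cat_induct)
  case zero
  have "mdom (lin_of (free_cat E) w :: ('o, ('o, 'e list) mor \<Rightarrow>\<^sub>0 int) mor) = A"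
    using M.lin_of_in_Hom[OF w] by (auto simp: Hom_linear_cat_iff)
  then show ?case
    using Hom_B_verts[OF x] Hom_B_verts[OF M.lin_of_in_Hom[OF w]] Zero_Cmp[OF h_in_Hom[OF w]]
    by (simp add: Cmp_zero_left s_zero)
next
  case (lin_of v)
  show ?case
    using M.Cmp_lin_of[OF lin_of w] s_lin_of[OF M.Cmp_in_Hom[OF lin_of w]] s_lin_of[OF lin_of]
      h_Cmp[OF lin_of w] by simp
next
  case (cancel y z)
  let ?w = "lin_of (free_cat E) w"
  note W = M.lin_of_in_Hom[OF w]
  note yw = B.Cmp_in_Hom[OF cancel(1) W] and zw = B.Cmp_in_Hom[OF cancel(2) W]
  note s = s_in_Hom[OF cancel(1)] s_in_Hom[OF cancel(2)]
  have "s (y \<cdot>\<^bsub>B\<^sub>0\<^esub> ?w) \<boxplus> s (z \<cdot>\<^bsub>B\<^sub>0\<^esub> ?w) = s y \<cdot> h w \<boxplus> s z \<cdot> h w"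
    using cancel(3) s_lin_add[OF yw zw] s_lin_add[OF cancel(1,2)] Cmp_left_linear[OF s h_in_Hom[OF w]]
    by (simp add: Cmp_lin_add_left)
  then show ?case
    using Add_right_cancel[OF Cmp_in_Hom[OF s(2) h_in_Hom[OF w]] s_in_Hom[OF yw]
        Cmp_in_Hom[OF s(1) h_in_Hom[OF w]]] cancel(4) by simp
qed

text \<open>All three facts come from \<open>frag_prod\<close> being a homomorphism into
  \<open>lift_group\<close> with prescribed basis values. For the first one its first component must
  also be recognized as \<open>s\<close>.\<close>

lemma
  assumes x: "x \<in> Hom B\<^sub>0 B D" and A: "A \<in> verts E"
  shows \<gamma>_additive: "lin_additive (free_cat E) A B (sV A) (s x) s (\<gamma> x)"
    and \<gamma>_lin_of: "w \<in> Hom (free_cat E) A B \<Longrightarrow> \<gamma> x (lin_of (free_cat E) w) = \<iota> (s x \<cdot> h w)"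
    and \<gamma>_zero: "\<gamma> x (Mor A B 0) = \<iota> (Zero F (sV A) (sV D))"
proof -
  define G where "G = lift_group (sV A) (s x)"
  define k where "k = (\<lambda>w. (h w, \<iota> (s x \<cdot> h w)))"
  note sx = s_in_Hom[OF x]
  interpret G: comm_group G
    using lift_comm_group[OF sx sV_in_Obj[OF A]] unfolding G_def .
  have k: "k \<in> Hom (free_cat E) A B \<rightarrow> carrier G"
    using lift_group_carrierI[OF sx h_in_Hom Idt_tracks[OF Cmp_in_Hom[OF sx h_in_Hom]]]
    by (auto simp: k_def G_def)
  have \<gamma>: "\<gamma> x y = snd (frag_prod G k (rep y))" if "y \<in> Hom B\<^sub>0 A B" for y
    using that by (auto simp: \<gamma>_def G_def k_def Hom_linear_cat_iff)
  have closed: "frag_prod G k (rep y) \<in> carrier G" if "y \<in> Hom B\<^sub>0 A B" for y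
    using G.frag_prod_closed[OF k] that by (simp add: Hom_linear_cat_iff)
  have add: "frag_prod G k (rep (lin_add y z)) = frag_prod G k (rep y) \<otimes>\<^bsub>G\<^esub> frag_prod G k (rep z)"
    if "y \<in> Hom B\<^sub>0 A B" "z \<in> Hom B\<^sub>0 A B" for y z
    using G.frag_prod_add[OF k] that by (simp add: Hom_linear_cat_iff)
  have of: "frag_prod G k (rep (lin_of (free_cat E) w)) = k w" if "w \<in> Hom (free_cat E) A B" for w
    using G.frag_prod_of[of k w] k that by (auto simp: lin_of_def)
  have B: "B \<in> verts E" "D \<in> verts E"
    using Hom_B_verts[OF x] by auto
  have zero: "frag_prod G k (rep (Mor A B 0)) = (Zero F (sV A) (sV B), \<iota> (Zero F (sV A) (sV D)))"
    using G.frag_prod_0[of k] lift_group_one[OF sx] unfolding G_def by simp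
  have frag_prod_eq: "frag_prod G k (rep y) = (s y, \<gamma> x y)" if "y \<in> Hom B\<^sub>0 A B" for y
  proof -
    \<comment> \<open>Projection to the first component is a homomorphism to the group of maps, and
      on words it has the same values as \<open>s\<close>.\<close>
    have "fst (frag_prod G k (rep y)) = s y"
      using that
    proof (induction y rule: linear_cat_induct)
      case zero
      then show ?case using s_zero[OF A B(1)] \<open>frag_prod G k (rep (Mor A B 0)) = _\<close> by simp
    next
      case (lin_of w)
      then show ?case using of s_lin_of by (simp add: k_def)
    next
      case (cancel y z)
      obtain m \<alpha> m' \<alpha>' where yz: "frag_prod G k (rep y) = (m, \<alpha>)" "frag_prod G k (rep z) = (m', \<alpha>')"
        by fastforce
      then have m: "m \<in> Hom F (sV A) (sV B)"
        using closed[OF cancel(1)] lift_group_carrier[OF sx] by (simp add: G_def)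
      have "m' = s z" "m \<boxplus> m' = s y \<boxplus> s z"
        using cancel(3,4) add[OF cancel(1,2)] yz s_lin_add[OF cancel(1,2)] by (simp_all add: G_def)
      then show ?case
        using Add_right_cancel[OF s_in_Hom[OF cancel(2)] m s_in_Hom[OF cancel(1)]] yz by simp
    qed
    then show ?thesis
      using \<gamma>[OF that] by (simp add: prod_eq_iff)
  qed
  show "lin_additive (free_cat E) A B (sV A) (s x) s (\<gamma> x)"
  proof (rule lin_additiveI[OF sx s_in_Hom])
    fix y assume y: "y \<in> Hom B\<^sub>0 A B"
    then show "\<gamma> x y \<in> tracks F (s x \<cdot> s y) (Tgt F (\<gamma> x y))"
      using closed[OF y] lift_group_carrier[OF sx] frag_prod_eq[OF y] by (simp add: G_def)
    fix z assume z: "z \<in> Hom B\<^sub>0 A B"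
    show "s (lin_add y z) = s y \<boxplus> s z"
      using s_lin_add[OF y z] .
    show "\<gamma> x (lin_add y z) = (\<gamma> x y \<uplus> \<gamma> x z) \<box> L (s x) (s y) (s z)"
      using add[OF y z] frag_prod_eq[OF y] frag_prod_eq[OF z] frag_prod_eq[OF lin_add_in_Hom[OF y z]]
      by (simp add: G_def)
  qed
  show "\<gamma> x (lin_of (free_cat E) w) = \<iota> (s x \<cdot> h w)" if "w \<in> Hom (free_cat E) A B"
    using \<gamma>[OF M.lin_of_in_Hom[OF that]] of[OF that] by (simp add: k_def)
  show "\<gamma> x (Mor A B 0) = \<iota> (Zero F (sV A) (sV D))"
    using \<gamma>[OF zero_in_Hom_linear_cat] zero A B by simp
qed

text \<open>Targets add without correction in a twisted sum, and \<open>s (x y)\<close> is additive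
  in \<open>y\<close> as well. This reduces the target to the case of a word, which is
  \<open>s_Cmp_lin_of\<close>.\<close>

lemma \<gamma>_tracks:
  assumes x: "x \<in> Hom B\<^sub>0 B D" and y: "y \<in> Hom B\<^sub>0 A B"
  shows "\<gamma> x y \<in> tracks F (s x \<cdot> s y) (s (x \<cdot>\<^bsub>B\<^sub>0\<^esub> y))"
proof -
  note A = Hom_B_verts(1)[OF y] and D = Hom_B_verts(2)[OF x]
  note sx = s_in_Hom[OF x]
  note add = lin_additiveD[OF \<gamma>_additive[OF x A] sx]
  have "Tgt F (\<gamma> x y) = s (x \<cdot>\<^bsub>B\<^sub>0\<^esub> y)"
    using y
  proof (induction y rule: linear_cat_induct)
    case zero
    have "mcod x = D" using x by (simp add: Hom_linear_cat_iff)
    then show ?case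
      using \<gamma>_zero[OF x A] s_zero[OF A D] Idt_tracks[OF Zero_in_Hom] sV_in_Obj A D
      by (simp add: Cmp_zero_right tracks_def)
  next
    case (lin_of w)
    then show ?case
      using \<gamma>_lin_of[OF x A lin_of] s_Cmp_lin_of[OF x lin_of] Idt_tracks[OF Cmp_in_Hom[OF sx h_in_Hom]]
      by (simp add: tracks_def)
  next
    case (cancel y z)
    note ya = add[OF cancel(1)] and za = add[OF cancel(2)]
    note xy = B.Cmp_in_Hom[OF x cancel(1)] and xz = B.Cmp_in_Hom[OF x cancel(2)]
    have tgt: "Tgt F (\<gamma> x y) \<in> Hom F (sV A) (sV D)"
      using ya(4) by (simp add: Arr_hom_gpd_iff)
    have "mdom y = mdom z"
      using cancel(1,2) by (simp add: Hom_linear_cat_iff)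
    then have "Tgt F (\<gamma> x y) \<boxplus> Tgt F (\<gamma> x z) = s (x \<cdot>\<^bsub>B\<^sub>0\<^esub> y) \<boxplus> s (x \<cdot>\<^bsub>B\<^sub>0\<^esub> z)"
      using lin_sum_tracks[OF sx ya(1) za(1) ya(2) za(2)] cancel(3) ya(6)[OF cancel(2)]
        s_lin_add[OF xy xz] by (simp add: tracks_def Cmp_lin_add_right)
    then show ?case
      using Add_right_cancel[OF s_in_Hom[OF xz] tgt s_in_Hom[OF xy]] cancel(4) by simp
  qed
  then show ?thesis
    using add(2)[OF y] by simp
qed

text \<open>In the variable \<open>y\<close> both sides are homomorphisms over the map
  \<open>s x \<boxplus> s x'\<close>, and on a word both are identity tracks.\<close>

lemma \<gamma>_lin_add_left:
  assumes x: "x \<in> Hom B\<^sub>0 B D" and x': "x' \<in> Hom B\<^sub>0 B D" and y: "y \<in> Hom B\<^sub>0 A B"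
  shows "\<gamma> (lin_add x x') y = \<gamma> x y \<uplus> \<gamma> x' y"
proof -
  note A = Hom_B_verts(1,3)[OF y] and sx = s_in_Hom[OF x] s_in_Hom[OF x']
  note xx = lin_add_in_Hom[OF x x']
  show ?thesis
  proof (rule lin_additive_unique[OF Add_in_Hom[OF sx] A(2) _
        lin_additive_add[OF sx \<gamma>_additive[OF x A(1)] \<gamma>_additive[OF x' A(1)]] _ y])
    show "lin_additive (free_cat E) A B (sV A) (s x \<boxplus> s x') s (\<gamma> (lin_add x x'))"
      using \<gamma>_additive[OF xx A(1)] s_lin_add[OF x x'] by simp
    fix w assume w: "w \<in> Hom (free_cat E) A B"
    show "\<gamma> (lin_add x x') (lin_of (free_cat E) w) =
        \<gamma> x (lin_of (free_cat E) w) \<uplus> \<gamma> x' (lin_of (free_cat E) w)"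
      using \<gamma>_lin_of[OF x A(1) w] \<gamma>_lin_of[OF x' A(1) w] \<gamma>_lin_of[OF xx A(1) w] s_lin_add[OF x x']
        Cmp_left_linear[OF sx h_in_Hom[OF w]]
        Tadd_Idt[OF Cmp_in_Hom[OF sx(1) h_in_Hom[OF w]] Cmp_in_Hom[OF sx(2) h_in_Hom[OF w]]]
      by simp
  qed
qed

text \<open>This is coherence with a word as third morphism. Here \<open>y\<close> varies: both
  sides are homomorphisms over \<open>s x\<close> with first component
  \<open>s y \<cdot> h w\<close>. If \<open>y\<close> is a word too, so is its composite with
  \<open>w\<close>, and both sides are identity tracks.\<close>

lemma \<gamma>_Cmp_lin_of:
  assumes x: "x \<in> Hom B\<^sub>0 D D'" and y: "y \<in> Hom B\<^sub>0 B D" and w: "w \<in> Hom (free_cat E) A B"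
  shows "\<gamma> x (y \<cdot>\<^bsub>B\<^sub>0\<^esub> lin_of (free_cat E) w) = \<gamma> x y \<star> \<iota> (h w)"
proof -
  let ?w = "lin_of (free_cat E) w"
  note W = M.lin_of_in_Hom[OF w]
  note A = Hom_B_verts(1,3)[OF W] and B = Hom_B_verts(1)[OF y]
  note sx = s_in_Hom[OF x] and hw = h_in_Hom[OF w]
  have f: "lin_additive (free_cat E) B D (sV A) (s x) (\<lambda>y. s y \<cdot> h w) (\<lambda>y. \<gamma> x (y \<cdot>\<^bsub>B\<^sub>0\<^esub> ?w))"
  proof (rule lin_additiveI[OF sx])
    fix y assume y: "y \<in> Hom B\<^sub>0 B D"
    note yw = B.Cmp_in_Hom[OF y W]
    note a = lin_additiveD[OF \<gamma>_additive[OF x A(1)] sx yw]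
    show "s y \<cdot> h w \<in> Hom F (sV A) (sV D)"
      using Cmp_in_Hom[OF s_in_Hom[OF y] hw] .
    show "\<gamma> x (y \<cdot>\<^bsub>B\<^sub>0\<^esub> ?w) \<in> tracks F (s x \<cdot> (s y \<cdot> h w)) (Tgt F (\<gamma> x (y \<cdot>\<^bsub>B\<^sub>0\<^esub> ?w)))"
      using a(2) s_Cmp_lin_of[OF y w] by simp
    fix z assume z: "z \<in> Hom B\<^sub>0 B D"
    note zw = B.Cmp_in_Hom[OF z W]
    show "s (lin_add y z) \<cdot> h w = s y \<cdot> h w \<boxplus> s z \<cdot> h w"
      using s_lin_add[OF y z] Cmp_left_linear[OF s_in_Hom[OF y] s_in_Hom[OF z] hw] by simp
    show "\<gamma> x (lin_add y z \<cdot>\<^bsub>B\<^sub>0\<^esub> ?w) =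
        (\<gamma> x (y \<cdot>\<^bsub>B\<^sub>0\<^esub> ?w) \<uplus> \<gamma> x (z \<cdot>\<^bsub>B\<^sub>0\<^esub> ?w)) \<box> L (s x) (s y \<cdot> h w) (s z \<cdot> h w)"
      using a(6)[OF zw] s_Cmp_lin_of[OF y w] s_Cmp_lin_of[OF z w] by (simp add: Cmp_lin_add_left)
  qed
  show ?thesis
  proof (rule lin_additive_unique[OF sx A(2) f lin_additive_precomp[OF sx \<gamma>_additive[OF x B] hw] _ y])
    fix v assume v: "v \<in> Hom (free_cat E) B D"
    show "\<gamma> x (lin_of (free_cat E) v \<cdot>\<^bsub>B\<^sub>0\<^esub> ?w) = \<gamma> x (lin_of (free_cat E) v) \<star> \<iota> (h w)"
      using \<gamma>_lin_of[OF x A(1) M.Cmp_in_Hom[OF v w]] M.Cmp_lin_of[OF v w] \<gamma>_lin_of[OF x B v]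
        h_Cmp[OF v w] Hcmp_Idt[OF Cmp_in_Hom[OF sx h_in_Hom[OF v]] hw]
        Cmp_assoc[OF sx h_in_Hom[OF v] hw] by simp
  qed
qed

text \<open>With \<open>z\<close> varying, both sides are homomorphisms over
  \<open>s x \<cdot> s y\<close>. The left one is the pullback of \<open>\<gamma> (x y)\<close>
  along the track \<open>\<gamma> x y\<close>, the right one the pasting of
  \<open>\<gamma> y z\<close> with \<open>\<gamma> x (y z)\<close>.\<close>

lemma \<gamma>_coherence:
  assumes x: "x \<in> Hom B\<^sub>0 D D'" and y: "y \<in> Hom B\<^sub>0 B D" and z: "z \<in> Hom B\<^sub>0 A B"
  shows "\<gamma> (x \<cdot>\<^bsub>B\<^sub>0\<^esub> y) z \<box> \<gamma> x y \<star> \<iota> (s z) = \<gamma> x (y \<cdot>\<^bsub>B\<^sub>0\<^esub> z) \<box> \<iota> (s x) \<star> \<gamma> y z"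
proof -
  note A = Hom_B_verts(1,3)[OF z]
  note sx = s_in_Hom[OF x] and sy = s_in_Hom[OF y] and xy = B.Cmp_in_Hom[OF x y]
  note sxy = Cmp_in_Hom[OF sx sy]
  have tgt: "Tgt F (\<gamma> y z) = s (y \<cdot>\<^bsub>B\<^sub>0\<^esub> z)" if "z \<in> Hom B\<^sub>0 A B" for z
    using \<gamma>_tracks[OF y that] by (simp add: tracks_def)
  have r: "lin_additive (free_cat E) A B (sV A) (s x) (\<lambda>z. s (y \<cdot>\<^bsub>B\<^sub>0\<^esub> z)) (\<lambda>z. \<gamma> x (y \<cdot>\<^bsub>B\<^sub>0\<^esub> z))"
    using B.Cmp_in_Hom[OF y]
    by (intro lin_additive_reindex[OF sx \<gamma>_additive[OF x A(1)]])
      (auto simp: Hom_linear_cat_iff intro!: Cmp_lin_add_right)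
  \<comment> \<open>\<open>lin_additive_comp\<close> expects the target of
    \<open>\<gamma> y z\<close> as first component; by \<open>tgt\<close> this is \<open>s\<close>
    of the composite.\<close>
  have r': "lin_additive (free_cat E) A B (sV A) (s x) (\<lambda>z. Tgt F (\<gamma> y z)) (\<lambda>z. \<gamma> x (y \<cdot>\<^bsub>B\<^sub>0\<^esub> z))"
    by (rule lin_additive_cong[OF r]) (simp add: tgt)
  show ?thesis
  proof (rule lin_additive_unique[OF sxy A(2)
        lin_additive_track[OF sxy \<gamma>_tracks[OF x y] \<gamma>_additive[OF xy A(1)]]
        lin_additive_comp[OF sx sy r' \<gamma>_additive[OF y A(1)]] _ z])
    fix w assume w: "w \<in> Hom (free_cat E) A B"
    let ?w = "lin_of (free_cat E) w"
    note W = M.lin_of_in_Hom[OF w] and hw = h_in_Hom[OF w]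
    \<comment> \<open>At a word the tracks \<open>\<gamma> (x y) w\<close> and
      \<open>\<gamma> y w\<close> are identities, which leaves only the behaviour of
      \<open>\<gamma> x\<close> under right multiplication of \<open>y\<close> by the word.\<close>
    have "\<gamma> (x \<cdot>\<^bsub>B\<^sub>0\<^esub> y) ?w \<box> \<gamma> x y \<star> \<iota> (s ?w) = \<gamma> x y \<star> \<iota> (h w)"
      using \<gamma>_lin_of[OF xy A(1) w] s_lin_of[OF w]
        Idt_Vcmp[OF Hcmp_tracks[OF sxy hw \<gamma>_tracks[OF x y] Idt_tracks[OF hw]]] by simp
    also have "\<dots> = \<gamma> x (y \<cdot>\<^bsub>B\<^sub>0\<^esub> ?w)"
      using \<gamma>_Cmp_lin_of[OF x y w] by simp
    also have "\<dots> = \<gamma> x (y \<cdot>\<^bsub>B\<^sub>0\<^esub> ?w) \<box> \<iota> (s x) \<star> \<gamma> y ?w"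
      using Vcmp_Idt[OF \<gamma>_tracks[OF x B.Cmp_in_Hom[OF y W]]] s_Cmp_lin_of[OF y w]
        \<gamma>_lin_of[OF y A(1) w] Hcmp_Idt[OF sx Cmp_in_Hom[OF sy hw]] by simp
    finally show "\<gamma> (x \<cdot>\<^bsub>B\<^sub>0\<^esub> y) ?w \<box> \<gamma> x y \<star> \<iota> (s ?w) =
        \<gamma> x (y \<cdot>\<^bsub>B\<^sub>0\<^esub> ?w) \<box> \<iota> (s x) \<star> \<gamma> y ?w" .
  qed
qed

lemma \<gamma>_Ide_left:
  assumes y: "y \<in> Hom B\<^sub>0 A B"
  shows "\<gamma> (Ide B\<^sub>0 B) y = \<iota> (s y)"
proof -
  note AB = Hom_B_verts[OF y]
  have i: "Ide B\<^sub>0 B \<in> Hom B\<^sub>0 B B" using B.Ide_in_Hom AB by simp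
  show ?thesis
  proof (rule lin_additive_unique[OF Ide_in_Hom[OF AB(4)] AB(3) _
        lin_additive_Idt[OF AB(4) s_in_Hom s_lin_add] _ y])
    show "lin_additive (free_cat E) A B (sV A) (Ide F (sV B)) s (\<gamma> (Ide B\<^sub>0 B))"
      using \<gamma>_additive[OF i AB(1)] s_Ide[OF AB(2)] by simp
    fix w assume w: "w \<in> Hom (free_cat E) A B"
    show "\<gamma> (Ide B\<^sub>0 B) (lin_of (free_cat E) w) = \<iota> (s (lin_of (free_cat E) w))"
      using \<gamma>_lin_of[OF i AB(1) w] s_Ide[OF AB(2)] Ide_Cmp[OF h_in_Hom[OF w]] s_lin_of[OF w] by simp
  qed
qed

text \<open>The identity of \<open>A\<close> is the empty word, so a basis value applies.\<close>

lemma \<gamma>_Ide_right: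
  assumes x: "x \<in> Hom B\<^sub>0 A B"
  shows "\<gamma> x (Ide B\<^sub>0 A) = \<iota> (s x)"
proof -
  note AB = Hom_B_verts[OF x]
  show ?thesis
    using \<gamma>_lin_of[OF x AB(1) M.Ide_in_Hom] M.Ide_linear_cat[of A] AB(1) h_Ide[of A]
      Cmp_Ide[OF s_in_Hom[OF x]] by simp
qed

end

theorem proposition5p8:
  fixes F :: "('o, 'm, 't) lin_track_cat"
    and L :: "'m \<Rightarrow> 'm \<Rightarrow> 'm \<Rightarrow> 't"
    and E :: "('o, 'e) pre_digraph"
    and hV :: "'o \<Rightarrow> 'o" and hE :: "'e \<Rightarrow> 'm set"
    and sV :: "'o \<Rightarrow> 'o" and sE :: "'e \<Rightarrow> 'm"
    and B\<^sub>0 :: "('o, ('o, ('o, 'e list) mor \<Rightarrow>\<^sub>0 int) mor) cat"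
    and s :: "('o, ('o, 'e list) mor \<Rightarrow>\<^sub>0 int) mor \<Rightarrow> 'm"
  assumes "left_linear_track_category F"
    and "linearity_tracks F L"
    and "generating_graph F E hV hE"
    and "graph_morphism E (under_graph F) sV sE"
    and "\<forall>v\<in>verts E. sV v = hV v" and "\<forall>e\<in>arcs E. htpy_class F (sE e) = hE e"
    and "B\<^sub>0 = linear_cat (free_cat E)"
    and "s = linear_extension (map_group F) sV (free_extension E F sV sE)"
  shows "\<exists>!\<Gamma>. \<Gamma> \<in> extensional (composable B\<^sub>0) \<and>
    pseudo_functor B\<^sub>0 F sV s \<Gamma> \<and>
    (\<forall>A B C. \<forall>x \<in> Hom B\<^sub>0 B C. \<forall>x' \<in> Hom B\<^sub>0 B C. \<forall>y \<in> Hom B\<^sub>0 A B.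
      \<Gamma> (lin_add x x', y) = \<Gamma> (x, y) \<uplus>\<^bsub>F\<^esub> \<Gamma> (x', y)) \<and>
    (\<forall>A B C. \<forall>x \<in> Hom B\<^sub>0 B C. \<forall>w \<in> Hom (free_cat E) A B.
      \<Gamma> (x, lin_of (free_cat E) w) = \<iota>\<^bsub>F\<^esub> (s (x \<cdot>\<^bsub>B\<^sub>0\<^esub> lin_of (free_cat E) w))) \<and>
    (\<forall>A B C. \<forall>x \<in> Hom B\<^sub>0 B C. \<forall>y \<in> Hom B\<^sub>0 A B. \<forall>z \<in> Hom B\<^sub>0 A B.
      \<Gamma> (x, lin_add y z) = (\<Gamma> (x, y) \<uplus>\<^bsub>F\<^esub> \<Gamma> (x, z)) \<box>\<^bsub>F\<^esub> L (s x) (s y) (s z))"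
proof -
  interpret lifted_graph F L E sV sE
    using assms(2-4) by (simp add: lifted_graph_def lifted_graph_axioms_def generating_graph_def)
  \<comment> \<open>Here \<open>B\<^sub>0\<close> and \<open>s\<close> are variables constrained by
    equations, whereas those of the locale are abbreviations; folding with these two facts
    translates between them.\<close>
  have B: "B\<^sub>0 = int_cat (free_cat E)" and s: "s = linear_extension (map_group F) sV h"
    using assms(7,8) by simp_all
  \<comment> \<open>Off the composable pairs the value is \<open>undefined\<close>, as membership in
    \<open>extensional\<close> requires; uniqueness is thereby an equality of functions.\<close>
  define \<Gamma> where "\<Gamma> = restrict (\<lambda>(x, y). \<gamma> x y) (composable B\<^sub>0)"
  have composable_Hom: "\<exists>A B D. x \<in> Hom B\<^sub>0 B D \<and> y \<in> Hom B\<^sub>0 A B" if "(x, y) \<in> composable B\<^sub>0" for x y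
    using that by (auto simp: composable_def Hom_def)
  have \<Gamma>: "\<Gamma> (x, y) = \<gamma> x y" if "x \<in> Hom B\<^sub>0 B D" "y \<in> Hom B\<^sub>0 A B" for x y A B D
    using that by (auto simp: \<Gamma>_def composable_def Hom_def)
  note in_B = B.Cmp_in_Hom[folded B]
  show ?thesis
  proof (rule ex1I[of _ \<Gamma>], intro conjI allI ballI)
    show "\<Gamma> \<in> extensional (composable B\<^sub>0)"
      by (simp add: \<Gamma>_def)
    show "pseudo_functor B\<^sub>0 F sV s \<Gamma>"
    proof (intro pseudo_functor.intro pseudo_functor_axioms.intro)
      show "category B\<^sub>0" "track_category F"
        unfolding B by unfold_locales
      show "sV A \<in> Obj F" if "A \<in> Obj B\<^sub>0" for A
        using that sV_in_Obj by (simp add: B)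
      show "s x \<in> Hom F (sV A) (sV A')" if "x \<in> Hom B\<^sub>0 A A'" for x A A'
        using that s_in_Hom by (simp add: B s)
      show "\<Gamma> (x, y) \<in> tracks F (s x \<cdot>\<^bsub>F\<^esub> s y) (s (x \<cdot>\<^bsub>B\<^sub>0\<^esub> y))" if "(x, y) \<in> composable B\<^sub>0" for x y
        using composable_Hom[OF that] \<Gamma> \<gamma>_tracks[folded B s] by metis
      show "\<Gamma> (x \<cdot>\<^bsub>B\<^sub>0\<^esub> y, z) \<box>\<^bsub>F\<^esub> \<Gamma> (x, y) \<star>\<^bsub>F\<^esub> \<iota>\<^bsub>F\<^esub> (s z) =
          \<Gamma> (x, y \<cdot>\<^bsub>B\<^sub>0\<^esub> z) \<box>\<^bsub>F\<^esub> \<iota>\<^bsub>F\<^esub> (s x) \<star>\<^bsub>F\<^esub> \<Gamma> (y, z)"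
        if xy: "(x, y) \<in> composable B\<^sub>0" and yz: "(y, z) \<in> composable B\<^sub>0" for x y z
      proof -
        obtain A A' D D' where x: "x \<in> Hom B\<^sub>0 D D'" and y: "y \<in> Hom B\<^sub>0 A' D" and z: "z \<in> Hom B\<^sub>0 A A'"
          using xy yz by (auto simp: composable_def Hom_def)
        show ?thesis
          using \<gamma>_coherence[folded B s, OF x y z] \<Gamma>[OF x y] \<Gamma>[OF y z] \<Gamma>[OF in_B[OF x y] z]
            \<Gamma>[OF x in_B[OF y z]] by simp
      qed
      show "s (Ide B\<^sub>0 A) = Ide F (sV A)" if "A \<in> Obj B\<^sub>0" for A
        using that s_Ide[folded B s] by (simp add: B)
      show "\<Gamma> (Ide B\<^sub>0 A', x) = \<iota>\<^bsub>F\<^esub> (s x)" "\<Gamma> (x, Ide B\<^sub>0 A) = \<iota>\<^bsub>F\<^esub> (s x)" if "x \<in> Hom B\<^sub>0 A A'" for x A A'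
        using \<gamma>_Ide_left[folded B s, OF that] \<gamma>_Ide_right[folded B s, OF that]
          \<Gamma>[OF B.Ide_in_Hom[folded B] that] \<Gamma>[OF that B.Ide_in_Hom[folded B]]
          B.Hom_Obj[folded B, OF that] by simp_all
    qed
  next
    fix A B C x x' y assume x: "x \<in> Hom B\<^sub>0 B C" "x' \<in> Hom B\<^sub>0 B C" and y: "y \<in> Hom B\<^sub>0 A B"
    show "\<Gamma> (lin_add x x', y) = \<Gamma> (x, y) \<uplus>\<^bsub>F\<^esub> \<Gamma> (x', y)"
      using \<gamma>_lin_add_left[folded B s, OF x y] \<Gamma>[OF _ y] x lin_add_in_Hom[OF x[unfolded B], folded B] by simp
  next
    fix A B C x w assume x: "x \<in> Hom B\<^sub>0 B C" and w: "w \<in> Hom (free_cat E) A B"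
    note W = M.lin_of_in_Hom[OF w]
    \<comment> \<open>The basis value is the identity of \<open>s x \<cdot> h w\<close>, which is
      the map \<open>s (x w)\<close> of the claim.\<close>
    show "\<Gamma> (x, lin_of (free_cat E) w) = \<iota>\<^bsub>F\<^esub> (s (x \<cdot>\<^bsub>B\<^sub>0\<^esub> lin_of (free_cat E) w))"
      using \<gamma>_lin_of[OF x[unfolded B] Hom_B_verts(1)[OF W] w] s_Cmp_lin_of[OF x[unfolded B] w]
        \<Gamma>[OF x W[folded B]] by (simp add: s B)
  next
    fix A B C x y z assume x: "x \<in> Hom B\<^sub>0 B C" and y: "y \<in> Hom B\<^sub>0 A B" and z: "z \<in> Hom B\<^sub>0 A B"
    show "\<Gamma> (x, lin_add y z) = (\<Gamma> (x, y) \<uplus>\<^bsub>F\<^esub> \<Gamma> (x, z)) \<box>\<^bsub>F\<^esub> L (s x) (s y) (s z)"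
      using lin_additiveD(6)[OF \<gamma>_additive s_in_Hom, folded B s, OF x _ x y z]
        Hom_B_verts(1)[folded B, OF y] \<Gamma>[OF x] y z lin_add_in_Hom[OF y[unfolded B] z[unfolded B], folded B]
      by simp
  next
    fix \<Delta> assume \<Delta>: "\<Delta> \<in> extensional (composable B\<^sub>0) \<and>
      pseudo_functor B\<^sub>0 F sV s \<Delta> \<and>
      (\<forall>A B C. \<forall>x \<in> Hom B\<^sub>0 B C. \<forall>x' \<in> Hom B\<^sub>0 B C. \<forall>y \<in> Hom B\<^sub>0 A B.
        \<Delta> (lin_add x x', y) = \<Delta> (x, y) \<uplus>\<^bsub>F\<^esub> \<Delta> (x', y)) \<and>
      (\<forall>A B C. \<forall>x \<in> Hom B\<^sub>0 B C. \<forall>w \<in> Hom (free_cat E) A B.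
        \<Delta> (x, lin_of (free_cat E) w) = \<iota>\<^bsub>F\<^esub> (s (x \<cdot>\<^bsub>B\<^sub>0\<^esub> lin_of (free_cat E) w))) \<and>
      (\<forall>A B C. \<forall>x \<in> Hom B\<^sub>0 B C. \<forall>y \<in> Hom B\<^sub>0 A B. \<forall>z \<in> Hom B\<^sub>0 A B.
        \<Delta> (x, lin_add y z) = (\<Delta> (x, y) \<uplus>\<^bsub>F\<^esub> \<Delta> (x, z)) \<box>\<^bsub>F\<^esub> L (s x) (s y) (s z))"
    then interpret \<Delta>: pseudo_functor B\<^sub>0 F sV s \<Delta>
      by blast
    show "\<Delta> = \<Gamma>"
    proof (rule extensionalityI[where A = "composable B\<^sub>0"])
      show "\<Delta> \<in> extensional (composable B\<^sub>0)" "\<Gamma> \<in> extensional (composable B\<^sub>0)"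
        using \<Delta> by (simp_all add: \<Gamma>_def)
      fix p assume p: "p \<in> composable B\<^sub>0"
      obtain x y where xy: "p = (x, y)"
        by fastforce
      then obtain A B D where x: "x \<in> Hom B\<^sub>0 B D" and y: "y \<in> Hom B\<^sub>0 A B"
        using composable_Hom p by blast
      note x' = x[unfolded B] and y' = y[unfolded B]
      note A = Hom_B_verts(1,3)[OF y']
      \<comment> \<open>For fixed \<open>x\<close>, the typing axiom of \<open>\<Delta>\<close> and
        the third condition make it a homomorphism in \<open>y\<close> over \<open>s x\<close>; the
        second condition gives it the values of \<open>\<gamma>\<close> on words.\<close>
      have "\<Delta> (x, y) = \<gamma> x y"
      proof (rule lin_additive_unique[OF s_in_Hom[OF x'] A(2) lin_additiveI[OF s_in_Hom[OF x'] s_in_Hom]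
            \<gamma>_additive[OF x' A(1)] _ y'])
        fix y assume y: "y \<in> Hom (int_cat (free_cat E)) A B"
        show "\<Delta> (x, y) \<in> tracks F (linear_extension (map_group F) sV h x \<cdot>\<^bsub>F\<^esub> linear_extension (map_group F) sV h y)
            (s (x \<cdot>\<^bsub>B\<^sub>0\<^esub> y))"
          using \<Delta>.track[of x y] x y by (auto simp: s composable_def Hom_def B)
        fix z assume z: "z \<in> Hom (int_cat (free_cat E)) A B"
        show "linear_extension (map_group F) sV h (lin_add y z) =
            linear_extension (map_group F) sV h y \<boxplus>\<^bsub>F\<^esub> linear_extension (map_group F) sV h z"
          using s_lin_add[OF y z] .
        show "\<Delta> (x, lin_add y z) = (\<Delta> (x, y) \<uplus>\<^bsub>F\<^esub> \<Delta> (x, z)) \<box>\<^bsub>F\<^esub>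
            L (linear_extension (map_group F) sV h x) (linear_extension (map_group F) sV h y)
              (linear_extension (map_group F) sV h z)"
          using \<Delta> x y z unfolding B s by blast
      next
        fix w assume w: "w \<in> Hom (free_cat E) A B"
        show "\<Delta> (x, lin_of (free_cat E) w) = \<gamma> x (lin_of (free_cat E) w)"
          using \<gamma>_lin_of[OF x' A(1) w] s_Cmp_lin_of[OF x' w] \<Delta> x w by (simp add: s B)
      qed
      then show "\<Delta> p = \<Gamma> p"
        using \<Gamma>[OF x y] xy by simp
    qed
  qed
qed

end
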